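(* The matrices $A,A^*\in \mathrm{Mat}_P(\mathbb{C})$ satisfy $$A^2A^{*}-(q+q^{-1})AA^{*}A+A^{*}A^{2}-\mathcal{Y}(AA^{*}+A^{*}A)-\mathcal{P} A^{*}=\Omega A+G,$$ $$A^{*2}A-(q+q^{-1}) A^*AA^*+AA^{*2}=\mathcal{Y}A^{*2}+\Omega A^{*}+G^{*},$$ where $$\mathcal{Y}=q^{\frac{h+k}{2}}\bigl(K_1K_2^{-1}+K_1^{-1}K_2\bigr)-q^{-1}(q-1)I,$$ $$\mathcal{P}=q(q-1)^{-2}\Bigl(\mathcal{Y}^2-q^{h+k-2}(q+1)^2I\Bigr),$$ $$\Omega=-q^{\frac{h+k}{2}-1}K_1^{-1}K_2\Bigl((q-1)\Omega_1+(q+1)I\Bigr)-q^{k-1}\Bigl((q-1)\Omega_2+(q+1)I\Bigr),$$ $$\begin{aligned}G=&-(q-1)^{-1}\biggl(q^{\frac{h+k}{2}-1}\Bigl(qK_1^{-1}K_2\mathcal{Y}-q^{\frac{h+k}{2}}(q+1)I\Bigr)\Omega_1+q^{k-1}\Bigl(q\mathcal{Y}-q^{\frac{h+k}{2}}(q+1)K_1^{-1}K_2\Bigr)\Omega_2\biggr)\\&-(q+1)(q-1)^{-2}\biggl(\Bigl(q^{\frac{h+k}{2}}K_1^{-1}K_2+q^k I\Bigr)\mathcal{Y}-q^{\frac{h+k}{2}-1}(q+1)\Bigl(q^{k}K_1^{-1}K_2+q^{\frac{h+k}{2}}I\Bigr)\biggr),\end{aligned}$$ $$G^*=q^{\fr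ac{h+3k}{2}-1}(q+1)\Omega_0K_1^{-1}K_2.$$
   Context: Let $h>k\geq 1$ be integers, $\mathbb{F}_q$ a finite field with $q$ elements, $\mathcal{V}$ an $(h+k)$-dimensional vector space over $\mathbb{F}_q$, and $P$ the set of all subspaces of $\mathcal{V}$. Fix $y\in P$ with $\dim y=k$. $\mathrm{Mat}_P(\mathbb{C})$ is the algebra of complex matrices with rows and columns indexed by $P$; $I$ is its identity; $q^{1/2}$ is the positive square root. For $0\le i\le k$, $0\le j\le h$ let $P_{i,j}=\{u\in P\mid \dim(u\cap y)=i,\ \dim u=i+j\}$; these sets partition $P$. For $u,v\in P$, $v$ covers $u$ if $u\subseteq v$ and $\dim v=\dim u+1$. If $v$ covers $u$, then $v$ $/$-covers $u$ if $\dim(v\cap y)=\dim(u\cap y)+1$, and $v$ $\backslash$-covers $u$ if $\dim(v\cap y)=\dim(u\cap y)$. The matrix $A$ has $(u,v)$-entry $1$ if each of $u,v$ covers $u\cap v$, and $0$ otherwise. The diagonal matrix $A^*$ has $(u,u)$-entry $q^{\dim(u\cap y)}$. $K_1,K_2$ are the diagonal matrices with $(K_1)_{u,u}=q^{\frac k2-i}$, $(K_2)_{u,u}=q^{j-\frac h2}$ for $u\in P_{i,j}$ (so $A^*=q^{k/2}K_1^{-1}$). $F^0,F^+,F^-$ are the $0/1$ matrices such that: $(F^0)_{u,v}=1$ iff $u+v$ $/$-covers both $u$ and $v$, and both $u$ and $v$ $\backslash$-cover $u\cap v$; $(F^+)_{u,v}=1$ iff $u+v$ $\backslash$-covers both $u$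 and $v$; $(F^-)_{u,v}=1$ iff both $u$ and $v$ $/$-cover $u\cap v$. Finally, $$\Omega_0=q^{-\frac{h+k}{2}}\Bigl((q-1)F^{0}K_1^{-1}K_2^{-1}+q^{\frac{h}{2}}K_1^{-1}+q^{\frac{k}{2}}K_2^{-1}-K_1^{-1}K_2^{-1}\Bigr),$$ $$\Omega_1=q^{-\frac{h}{2}}\Bigl(qF^{0}K_2^{-1}+(q-1)F^{-}K_2^{-1}+\tfrac{q^{\frac{k}{2}+1}K_1K_2^{-1}+q^{\frac{h+k}{2}+1}K_1^{-1}-qK_2^{-1}}{q-1}\Bigr)-\tfrac{q}{q-1}I,$$ $$\Omega_2=q^{-\frac{k}{2}}\Bigl(qF^0K_1^{-1}+(q-1)F^{+}K_1^{-1}+\tfrac{q^{\frac{h}{2}+1}K_1^{-1}K_2+q^{\frac{h+k}{2}+1}K_2^{-1}-qK_1^{-1}}{q-1}\Bigr)-\tfrac{q}{q-1}I.$$ *)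

theory Defs
  imports "HOL-Analysis.Analysis"
begin

text \<open>
  The ambient space is a type \<open>'v\<close> that is a vector space over a finite field \<open>'f\<close> via \<open>scale\<close>.
  The set \<open>P\<close> of its subspaces depends on \<open>scale\<close> and so is not itself a type.  To use the library's
  matrices, \<open>P\<close> is labelled by an arbitrary finite type \<open>'p\<close>: the index \<open>u\<close> stands for the subspace
  \<open>sub u\<close>, and theorems assume \<open>bij_betw sub UNIV {U. module.subspace scale U}\<close>.  Thus
  \<open>complex ^ 'p ^ 'p\<close> is \<open>Mat\<^sub>P(\<complex>)\<close>.  The sum \<open>U + W\<close> of subspaces is the elementwise sum of sets.
\<close>

context
  fixes scale :: "'f::{field,finite} \<Rightarrow> 'v::ab_group_add \<Rightarrow> 'v"
begin

definition covers :: "'v set \<Rightarrow> 'v set \<Rightarrow> bool" where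
  "covers v u \<longleftrightarrow> u \<subseteq> v \<and> vector_space.dim scale v = vector_space.dim scale u + 1"

definition slash_covers :: "'v set \<Rightarrow> 'v set \<Rightarrow> 'v set \<Rightarrow> bool" where
  "slash_covers y v u \<longleftrightarrow> covers v u \<and>
     vector_space.dim scale (v \<inter> y) = vector_space.dim scale (u \<inter> y) + 1"

definition backslash_covers :: "'v set \<Rightarrow> 'v set \<Rightarrow> 'v set \<Rightarrow> bool" where
  "backslash_covers y v u \<longleftrightarrow> covers v u \<and>
     vector_space.dim scale (v \<inter> y) = vector_space.dim scale (u \<inter> y)"

text \<open>\<open>P\<^sub>i\<^sub>,\<^sub>j\<close>\<close>

definition level :: "'v set \<Rightarrow> nat \<Rightarrow> nat \<Rightarrow> 'v set set" where
  "level y i j = {u. module.subspace scale u \<and>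
     vector_space.dim scale (u \<inter> y) = i \<and> vector_space.dim scale u = i + j}"

end

definition diag_mat :: "('p::finite \<Rightarrow> real) \<Rightarrow> complex ^ 'p ^ 'p" where
  "diag_mat d = (\<chi> u v. if u = v then complex_of_real (d u) else 0)"

definition zero_one_mat :: "('p::finite \<Rightarrow> 'p \<Rightarrow> bool) \<Rightarrow> complex ^ 'p ^ 'p" where
  "zero_one_mat R = (\<chi> u v. if R u v then 1 else 0)"

context
  fixes scale :: "'f::{field,finite} \<Rightarrow> 'v::ab_group_add \<Rightarrow> 'v"
    and sub :: "'p::finite \<Rightarrow> 'v set"
    and y :: "'v set"
    and h k :: nat
begin

definition A_mat :: "complex ^ 'p ^ 'p" where
  "A_mat = zero_one_mat (\<lambda>u v.
     covers scale (sub u) (sub u \<inter> sub v) \<and> covers scale (sub v) (sub u \<inter> sub v))"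

definition Astar_mat :: "complex ^ 'p ^ 'p" where
  "Astar_mat = diag_mat (\<lambda>u. real CARD('f) ^ vector_space.dim scale (sub u \<inter> y))"

text \<open>
  For a subspace \<open>u\<close> the pair \<open>(i, j)\<close> with \<open>u \<in> level scale y i j\<close> is unique.
\<close>

definition K1_mat :: "complex ^ 'p ^ 'p" where
  "K1_mat = diag_mat (\<lambda>u. let (i, j) = (THE (i, j). sub u \<in> level scale y i j)
     in real CARD('f) powr (real k / 2 - real i))"

definition K2_mat :: "complex ^ 'p ^ 'p" where
  "K2_mat = diag_mat (\<lambda>u. let (i, j) = (THE (i, j). sub u \<in> level scale y i j)
     in real CARD('f) powr (real j - real h / 2))"

definition F0_mat :: "complex ^ 'p ^ 'p" where
  "F0_mat = zero_one_mat (\<lambda>u v.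
     slash_covers scale y (sub u + sub v) (sub u) \<and>
     slash_covers scale y (sub u + sub v) (sub v) \<and>
     backslash_covers scale y (sub u) (sub u \<inter> sub v) \<and>
     backslash_covers scale y (sub v) (sub u \<inter> sub v))"

definition Fplus_mat :: "complex ^ 'p ^ 'p" where
  "Fplus_mat = zero_one_mat (\<lambda>u v.
     backslash_covers scale y (sub u + sub v) (sub u) \<and>
     backslash_covers scale y (sub u + sub v) (sub v))"

definition Fminus_mat :: "complex ^ 'p ^ 'p" where
  "Fminus_mat = zero_one_mat (\<lambda>u v.
     slash_covers scale y (sub u) (sub u \<inter> sub v) \<and>
     slash_covers scale y (sub v) (sub u \<inter> sub v))"

definition Omega0_mat :: "complex ^ 'p ^ 'p" where
  "Omega0_mat = (let q = real CARD('f); h = real h; k = real k;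
       K1' = matrix_inv K1_mat; K2' = matrix_inv K2_mat; F0 = F0_mat
     in q powr (- (h + k) / 2) *\<^sub>R
       ((q - 1) *\<^sub>R (F0 ** K1' ** K2') + q powr (h / 2) *\<^sub>R K1' + q powr (k / 2) *\<^sub>R K2' - K1' ** K2'))"

definition Omega1_mat :: "complex ^ 'p ^ 'p" where
  "Omega1_mat = (let q = real CARD('f); h = real h; k = real k;
       K1 = K1_mat; K1' = matrix_inv K1; K2' = matrix_inv K2_mat; F0 = F0_mat; Fm = Fminus_mat
     in q powr (- h / 2) *\<^sub>R
       (q *\<^sub>R (F0 ** K2') + (q - 1) *\<^sub>R (Fm ** K2')
        + (1 / (q - 1)) *\<^sub>R
            (q powr (k / 2 + 1) *\<^sub>R (K1 ** K2') + q powr ((h + k) / 2 + 1) *\<^sub>R K1' - q *\<^sub>R K2'))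
       - (q / (q - 1)) *\<^sub>R mat 1)"

definition Omega2_mat :: "complex ^ 'p ^ 'p" where
  "Omega2_mat = (let q = real CARD('f); h = real h; k = real k;
       K1' = matrix_inv K1_mat; K2 = K2_mat; K2' = matrix_inv K2; F0 = F0_mat; Fp = Fplus_mat
     in q powr (- k / 2) *\<^sub>R
       (q *\<^sub>R (F0 ** K1') + (q - 1) *\<^sub>R (Fp ** K1')
        + (1 / (q - 1)) *\<^sub>R
            (q powr (h / 2 + 1) *\<^sub>R (K1' ** K2) + q powr ((h + k) / 2 + 1) *\<^sub>R K2' - q *\<^sub>R K1'))
       - (q / (q - 1)) *\<^sub>R mat 1)"

end

end

theory Submission
  imports Defs
begin

text \<open>
  Write \<open>i = dim (u \<inter> y)\<close> and \<open>j = dim u - i\<close> for the level of a subspace \<open>u\<close>.  The idea is to factor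
  adjacency through covers.  Let \<open>L1\<close> and \<open>L2\<close> be the incidence matrices of the slash and of the
  backslash covers (the row is the smaller subspace), and let \<open>R1\<close>, \<open>R2\<close> be their transposes.
  They raise or lower the level by one step, so every diagonal matrix that depends on the level only
  (such as \<open>A*\<close>, \<open>K\<^sub>1\<close>, \<open>K\<^sub>2\<close>, \<open>Y\<close>, \<open>P\<close>) can be moved past them at the price of rescaling
  its arguments \<open>q\<^sup>i\<close> and \<open>q\<^sup>j\<close>.

  The geometry of the lattice enters through a handful of quadratic relations.
  \<^item> Two-step chains: \<open>L2 L1 = q L1 L2\<close>, since an interval of length two in which \<open>i\<close> increases by
    one has \<open>q + 1\<close> middle elements, exactly one of which gains the dimension of \<open>u \<inter> y\<close> first.
  \<^item> Squares \<open>u \<inter> v, u, v, u + v\<close>: by modularity, \<open>L1 R2 = R2 L1\<close> and \<open>R1 L2 = L2 R1\<close>.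
    These two products, called \<open>Rise\<close> and \<open>Fall\<close> below, are the part of \<open>A\<close> that changes the level.
  \<^item> The products of a cover matrix with its transpose are \<open>F\<^sup>0 + F\<^sup>-\<close>, \<open>F\<^sup>-\<close>, \<open>F\<^sup>+\<close>,
    \<open>F\<^sup>0 + F\<^sup>+\<close> up to a diagonal of Gaussian numbers that count the covers of one kind.

  Hence \<open>A = F\<^sup>0 + F\<^sup>+ + F\<^sup>- + Rise + Fall\<close>, and \<open>F\<^sup>0\<close> is a commutator of cover matrices in two
  different ways: \<open>[L1, R1]\<close> and \<open>[R2, L2]\<close> up to diagonals.  Using the expression whose letters both
  commute or \<open>q\<close>-commute with a given cover matrix shows that \<open>F\<^sup>0\<close> itself \<open>q\<close>-commutes with all
  four, up to lower terms.  With these rules every word can be put in the order \<open>L, F\<^sup>0, R\<close>.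

  Both relations of the theorem are then sorted by the change of \<open>i\<close>.
  Since \<open>A A* = A* (q Rise + q\<^sup>-\<^sup>1 Fall + F)\<close> with \<open>F = F\<^sup>0 + F\<^sup>+ + F\<^sup>-\<close>, the parts of the first relation
  that change \<open>i\<close> by two cancel because \<open>q + q\<^sup>-\<^sup>1\<close> is the coefficient in the middle.  The parts that
  change it by \<open>1\<close>, by \<open>-1\<close> and by \<open>0\<close> are the lemmas \<open>F_Rise\<close>, \<open>F_Fall\<close> and \<open>F0_F\<close>; the last one
  rests on the fact that \<open>F\<^sup>0\<close> and \<open>F\<^sup>-\<close> commute.  In the second relation the level-changing parts cancel
  for the same reason and a comparison of the coefficients of \<open>F\<^sup>0\<close>, \<open>F\<^sup>+\<close>, \<open>F\<^sup>-\<close> and the identity remains.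
\<close>

section \<open>Counting subspaces of a finite vector space\<close>

locale finite_space = finite_dimensional_vector_space scale Basis
  for scale :: "'f::{field,finite} \<Rightarrow> 'v::ab_group_add \<Rightarrow> 'v" and Basis
begin

text \<open>
  Induction on the basis: \<open>(c, s) \<mapsto> c x + s\<close> is a bijection onto the span of \<open>insert x B\<close>, because two
  representations with different \<open>c\<close> would put \<open>x\<close> into the span of \<open>B\<close>.
\<close>

lemma card_span_independent:
  assumes "finite B" "independent B"
  shows "finite (span B) \<and> card (span B) = CARD('f) ^ card B"
  using assms
proof (induction B rule: finite_induct)
  case empty
  then show ?case by simp
next
  case (insert x B)
  have ind: "independent B" and x: "x \<notin> span B"
    using insert.prems insert.hyps by (auto simp: independent_insert)
  let ?f = "\<lambda>(c, s). scale c x + s"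
  have "inj_on ?f (UNIV \<times> span B)"
  proof (rule inj_onI, clarify)
    fix c s d t assume s: "s \<in> span B" "t \<in> span B" and e: "scale c x + s = scale d x + t"
    have d: "scale (c - d) x = t - s" using e by (simp add: scale_left_diff_distrib algebra_simps)
    have "c = d"
    proof (rule ccontr)
      assume "c \<noteq> d"
      have "scale (inverse (c - d)) (t - s) \<in> span B" by (intro span_scale span_diff s)
      hence "x \<in> span B" using \<open>c \<noteq> d\<close> by (simp flip: d)
      with x show False by blast
    qed
    with e show "c = d \<and> s = t" by simp
  qed
  moreover have "?f ` (UNIV \<times> span B) = span (insert x B)"
  proof safe
    fix c s assume s: "s \<in> span B"
    show "scale c x + s \<in> span (insert x B)"
      using s span_mono[of B "insert x B"] by (intro span_add span_scale) (auto intro: span_base)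
  next
    fix v assume "v \<in> span (insert x B)"
    then obtain k where "v - scale k x \<in> span B" by (auto simp: span_insert)
    thus "v \<in> ?f ` (UNIV \<times> span B)" by (intro image_eqI[of _ _ "(k, v - scale k x)"]) auto
  qed
  ultimately have "bij_betw ?f (UNIV \<times> span B) (span (insert x B))" by (simp add: bij_betw_def)
  then have "card (span (insert x B)) = card ((UNIV :: 'f set) \<times> span B)"
    and "finite (span (insert x B))"
    using insert.IH[OF ind] bij_betw_finite[of ?f "UNIV \<times> span B"] bij_betw_same_card[of ?f]
    by (simp_all add: finite_cartesian_product)
  with insert ind show ?case by (simp add: card_cartesian_product)
qed

lemma card_subspace: assumes "subspace U" shows "card U = CARD('f) ^ dim U"
proof -
  obtain B where "B \<subseteq> U" "independent B" "U \<subseteq> span B" "card B = dim U" using basis_exists by blast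
  moreover have "span B = U" using calculation assms by (simp add: span_subspace)
  ultimately show ?thesis using card_span_independent[of B] finiteI_independent by auto
qed

lemma finite_UNIV_space: "finite (UNIV :: 'v set)"
proof -
  have "finite (span Basis)" using card_span_independent[OF finite_Basis independent_Basis] by blast
  thus ?thesis by (simp only: span_Basis)
qed

lemma finite_set_space [simp]: "finite (S :: 'v set)"
  by (rule finite_subset[OF subset_UNIV finite_UNIV_space])

lemma finite_sets_space [simp]: "finite (S :: 'v set set)"
proof (rule finite_subset)
  show "finite (Pow (UNIV :: 'v set))" using finite_UNIV_space by (simp only: finite_Pow_iff)
qed (simp only: Pow_UNIV subset_UNIV)

lemma real_card_Diff:
  fixes S T :: "'v set"
  shows "T \<subseteq> S \<Longrightarrow> real (card (S - T)) = real (card S) - real (card T)"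
  by (simp add: card_Diff_subset card_mono of_nat_diff)

lemma q_gt_1: "1 < real CARD('f)"
proof -
  have "card {0, 1 :: 'f} \<le> CARD('f)" by (intro card_mono) auto
  thus ?thesis by simp
qed

lemma subspace_plus: "subspace U \<Longrightarrow> subspace W \<Longrightarrow> subspace (U + W)"
proof -
  assume "subspace U" "subspace W"
  moreover have "U + W = {x + y |x y. x \<in> U \<and> y \<in> W}" by (auto simp: set_plus_def)
  ultimately show ?thesis using subspace_sums[of U W] by simp
qed

lemma dim_plus_inter:
  assumes "subspace U" "subspace W" shows "dim (U + W) + dim (U \<inter> W) = dim U + dim W"
proof -
  have "U + W = {x + y |x y. x \<in> U \<and> y \<in> W}" by (auto simp: set_plus_def)
  thus ?thesis using dim_sums_Int[OF assms] by simp
qed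

lemma plus_le: "subspace W \<Longrightarrow> U \<subseteq> W \<Longrightarrow> U' \<subseteq> W \<Longrightarrow> U + U' \<subseteq> W"
  by (auto simp: set_plus_def intro: subspace_add)

lemma le_plus: assumes "subspace U" "subspace W" shows "U \<subseteq> U + W" "W \<subseteq> U + W"
  using subspace_0[OF assms(1)] subspace_0[OF assms(2)]
  by (auto simp: set_plus_def) (metis add.right_neutral, metis add.left_neutral)

lemma subspace_eqI: "subspace U \<Longrightarrow> subspace W \<Longrightarrow> U \<subseteq> W \<Longrightarrow> dim W \<le> dim U \<Longrightarrow> U = W"
  using subspace_dim_equal by blast

lemma dim_insert_subspace: "subspace u \<Longrightarrow> x \<notin> u \<Longrightarrow> dim (insert x u) = Suc (dim u)"
  by (simp add: dim_insert span_eq_iff[THEN iffD2])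

text \<open>
  A cover is either a slash or a backslash cover, because \<open>v \<inter> S\<close> and \<open>u\<close> both lie in \<open>v\<close>, whose
  dimension exceeds that of \<open>u\<close> by one only; the dimension formula for \<open>(v \<inter> S) + u\<close> gives the bound.
\<close>

lemma dim_inter_cover:
  assumes "subspace u" "subspace v" "subspace S" "covers scale v u"
  shows "dim (u \<inter> S) \<le> dim (v \<inter> S)" "dim (v \<inter> S) \<le> dim (u \<inter> S) + 1"
proof -
  have uv: "u \<subseteq> v" "dim v = dim u + 1" using assms(4) by (auto simp: covers_def)
  show "dim (u \<inter> S) \<le> dim (v \<inter> S)" using uv by (intro dim_subset) auto
  have "dim ((v \<inter> S) + u) + dim ((v \<inter> S) \<inter> u) = dim (v \<inter> S) + dim u"
    using assms by (intro dim_plus_inter subspace_inter)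
  moreover have "dim ((v \<inter> S) + u) \<le> dim v" using uv assms by (intro dim_subset plus_le) auto
  moreover have "(v \<inter> S) \<inter> u = u \<inter> S" using uv by auto
  ultimately show "dim (v \<inter> S) \<le> dim (u \<inter> S) + 1" using uv by simp
qed

lemma covers_cases:
  assumes "subspace u" "subspace v" "subspace S" "covers scale v u"
  shows "slash_covers scale S v u \<or> backslash_covers scale S v u"
  using dim_inter_cover[OF assms] assms by (auto simp: slash_covers_def backslash_covers_def)

lemma cover_eq_span:
  assumes "subspace u" "subspace w" "covers scale w u" "x \<in> w" "x \<notin> u"
  shows "w = span (insert x u)"
proof (rule sym, rule subspace_eqI)
  show "span (insert x u) \<subseteq> w" using assms by (intro span_minimal) (auto simp: covers_def)
  show "dim w \<le> dim (span (insert x u))" using assms by (simp add: dim_insert_subspace covers_def)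
qed (use assms in auto)

text \<open>
  The covers \<open>w\<close> of \<open>u\<close> that gain a dimension inside \<open>S\<close> are the spans of \<open>u\<close> and a vector of \<open>S - u\<close>.
  So the sets \<open>w \<inter> S - u\<close> partition \<open>S - u\<close>, and they all have \<open>q\<^sup>i (q - 1)\<close> elements, where
  \<open>i = dim (u \<inter> S)\<close>.  For \<open>S = y\<close> these are the slash covers, for \<open>S = UNIV\<close> all covers.
\<close>

lemma card_covers:
  assumes u: "subspace u" and S: "subspace S"
  shows "real (card {w. subspace w \<and> covers scale w u \<and> dim (w \<inter> S) = dim (u \<inter> S) + 1}) * (real CARD('f) - 1)
     = real CARD('f) ^ (dim S - dim (u \<inter> S)) - 1"
proof -
  define T where "T = {w. subspace w \<and> covers scale w u \<and> dim (w \<inter> S) = dim (u \<inter> S) + 1}"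
  define i where "i = dim (u \<inter> S)"
  define Q where "Q = real CARD('f)"
  have Q: "Q > 1" using q_gt_1 by (simp add: Q_def)
  have iS: "i \<le> dim S" unfolding i_def by (intro dim_subset) auto
  have "S - u = (\<Union>w\<in>T. w \<inter> S - u)"
  proof safe
    fix x assume x: "x \<in> S" "x \<notin> u"
    let ?w = "span (insert x u)"
    have c: "covers scale ?w u" using x u span_superset[of "insert x u"] by (auto simp: covers_def dim_insert_subspace)
    have "u \<inter> S \<subset> ?w \<inter> S" using x span_superset[of "insert x u"] by auto
    hence "dim (u \<inter> S) < dim (?w \<inter> S)"
      by (intro dim_psubset) (use u S in \<open>simp add: span_eq_iff[THEN iffD2] subspace_inter\<close>)
    with dim_inter_cover[OF u _ S c] have "?w \<in> T" unfolding T_def using c by auto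
    thus "x \<in> (\<Union>w\<in>T. w \<inter> S - u)" using x span_superset[of "insert x u"] by auto
  qed
  moreover have "card (\<Union>w\<in>T. w \<inter> S - u) = (\<Sum>w\<in>T. card (w \<inter> S - u))"
  proof (intro card_UN_disjoint ballI impI)
    fix w w' assume w: "w \<in> T" "w' \<in> T" "w \<noteq> w'"
    show "(w \<inter> S - u) \<inter> (w' \<inter> S - u) = {}"
    proof (rule ccontr)
      assume "(w \<inter> S - u) \<inter> (w' \<inter> S - u) \<noteq> {}"
      then obtain x where "x \<in> w" "x \<in> w'" "x \<notin> u" by auto
      with w show False using cover_eq_span[OF u] unfolding T_def by blast
    qed
  qed auto
  moreover have "real (card (w \<inter> S - u)) = Q ^ i * (Q - 1)" if "w \<in> T" for w
  proof -
    have w: "subspace w" "u \<subseteq> w" "dim (w \<inter> S) = i + 1" using that by (auto simp: T_def covers_def i_def)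
    have "w \<inter> S - u = w \<inter> S - u \<inter> S" by auto
    hence "real (card (w \<inter> S - u)) = real (card (w \<inter> S)) - real (card (u \<inter> S))"
      using w by (simp only:) (rule real_card_Diff, auto)
    thus ?thesis using w u S by (simp add: card_subspace subspace_inter Q_def i_def algebra_simps)
  qed
  moreover have "real (card (S - u)) = Q ^ dim S - Q ^ i"
  proof -
    have "S - u = S - u \<inter> S" by auto
    hence "real (card (S - u)) = real (card S) - real (card (u \<inter> S))"
      by (simp only:) (rule real_card_Diff, auto)
    thus ?thesis using u S by (simp add: card_subspace subspace_inter Q_def i_def)
  qed
  ultimately have "real (card T) * (Q ^ i * (Q - 1)) = Q ^ dim S - Q ^ i" by simp
  also have "\<dots> = Q ^ i * (Q ^ (dim S - i) - 1)" using iS by (simp add: right_diff_distrib flip: power_add)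
  finally have "Q ^ i * (real (card T) * (Q - 1)) = Q ^ i * (Q ^ (dim S - i) - 1)" by (simp add: algebra_simps)
  thus ?thesis using Q by (simp add: T_def Q_def i_def)
qed

text \<open>
  Induction on the codimension of \<open>z\<close>.  Double counting of the pairs \<open>(w, x)\<close> with \<open>x \<in> w - z\<close>, by
  hyperplanes and by vectors, expresses the count for \<open>z\<close> by the counts for \<open>span (insert x z)\<close>, which
  have codimension one less.
\<close>

lemma card_hyperplanes:
  assumes "subspace z" "subspace u" "z \<subseteq> u"
  shows "real (card {w. subspace w \<and> z \<subseteq> w \<and> covers scale u w}) * (real CARD('f) - 1)
     = real CARD('f) ^ (dim u - dim z) - 1"
  using assms
proof (induction "dim u - dim z" arbitrary: z)
  case 0
  have "z = u" using 0 by (intro subspace_eqI) auto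
  then have "{w. subspace w \<and> z \<subseteq> w \<and> covers scale u w} = {}" by (auto simp: covers_def)
  then show ?case using 0 by simp
next
  case (Suc m)
  define H where "H z = {w. subspace w \<and> z \<subseteq> w \<and> covers scale u w}" for z
  define Q where "Q = real CARD('f)"
  have Q: "Q > 1" using q_gt_1 by (simp add: Q_def)
  have dz: "dim u = dim z + Suc m" using Suc.hyps(2) by simp
  show ?case
  \<comment> \<open>In codimension one the double count reads \<open>0 = 0\<close>, so that this case is settled directly.\<close>
  proof (cases "m = 0")
    case True
    have "H z = {z}"
    proof safe
      fix w x assume "w \<in> H z"
      hence "z = w" using Suc.prems dz True by (intro subspace_eqI) (auto simp: H_def covers_def)
      thus "x \<in> w \<Longrightarrow> x \<in> z" "x \<in> z \<Longrightarrow> x \<in> w" by auto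
    qed (use Suc.prems dz True in \<open>auto simp: H_def covers_def\<close>)
    then show ?thesis using dz True by (simp add: H_def)
  next
    case False
    have "(\<Sum>w\<in>H z. card (w - z)) = (\<Sum>w\<in>H z. \<Sum>x\<in>u - z. if x \<in> w then 1 else 0)"
    proof (rule sum.cong)
      fix w assume "w \<in> H z"
      hence "w - z = {x \<in> u - z. x \<in> w}" by (auto simp: H_def covers_def)
      thus "card (w - z) = (\<Sum>x\<in>u - z. if x \<in> w then 1 else 0)" by (simp add: sum.If_cases Int_def)
    qed simp
    also have "\<dots> = (\<Sum>x\<in>u - z. \<Sum>w\<in>H z. if x \<in> w then 1 else 0)" by (rule sum.swap)
    also have "\<dots> = (\<Sum>x\<in>u - z. card (H (span (insert x z))))"
    proof (rule sum.cong)
      fix x assume "x \<in> u - z"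
      have "span (insert x z) \<subseteq> w \<longleftrightarrow> z \<subseteq> w \<and> x \<in> w" if "subspace w" for w
        using that span_superset[of "insert x z"] span_minimal[of "insert x z" w] by blast
      hence "H (span (insert x z)) = {w \<in> H z. x \<in> w}" unfolding H_def by blast
      thus "(\<Sum>w\<in>H z. if x \<in> w then 1 else 0) = card (H (span (insert x z)))" by (simp add: sum.If_cases Int_def)
    qed simp
    finally have eq: "(\<Sum>w\<in>H z. real (card (w - z))) = (\<Sum>x\<in>u - z. real (card (H (span (insert x z)))))"
      by (metis (no_types, lifting) of_nat_sum sum.cong)
    have "real (card (w - z)) = Q ^ dim z * (Q ^ m - 1)" if "w \<in> H z" for w
    proof -
      have w: "subspace w" "z \<subseteq> w" "dim w = dim z + m" using that dz by (auto simp: H_def covers_def)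
      hence "real (card (w - z)) = real (card w) - real (card z)"
        by (intro real_card_Diff)
      thus ?thesis using w Suc.prems by (simp add: card_subspace Q_def power_add algebra_simps)
    qed
    hence e1: "(\<Sum>w\<in>H z. real (card (w - z))) = real (card (H z)) * (Q ^ dim z * (Q ^ m - 1))" by simp
    have "real (card (H (span (insert x z)))) * (Q - 1) = Q ^ m - 1" if "x \<in> u - z" for x
    proof -
      have d: "dim (span (insert x z)) = dim z + 1" using that Suc.prems by (auto simp: dim_insert_subspace)
      have "span (insert x z) \<subseteq> u" using that Suc.prems by (intro span_minimal) auto
      thus ?thesis using Suc.hyps(1)[of "span (insert x z)"] d dz Suc.prems by (simp add: H_def Q_def)
    qed
    hence e2: "(\<Sum>x\<in>u - z. real (card (H (span (insert x z))))) * (Q - 1) = real (card (u - z)) * (Q ^ m - 1)"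
      by (simp add: sum_distrib_right)
    have e3: "real (card (u - z)) = Q ^ dim z * (Q ^ Suc m - 1)"
    proof -
      have "real (card (u - z)) = real (card u) - real (card z)"
        using Suc.prems by (intro real_card_Diff)
      thus ?thesis using Suc.prems dz by (simp add: card_subspace Q_def power_add algebra_simps)
    qed
    have "(Q ^ dim z * (Q ^ m - 1)) * (real (card (H z)) * (Q - 1)) = (\<Sum>w\<in>H z. real (card (w - z))) * (Q - 1)"
      by (simp only: e1 mult_ac)
    also have "\<dots> = (Q ^ dim z * (Q ^ m - 1)) * (Q ^ Suc m - 1)"
      unfolding eq e2 e3 by (simp only: mult_ac)
    finally have "(Q ^ dim z * (Q ^ m - 1)) * (real (card (H z)) * (Q - 1)) = (Q ^ dim z * (Q ^ m - 1)) * (Q ^ Suc m - 1)" .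
    moreover have "1 < Q ^ m" using False by (intro one_less_power Q) simp
    ultimately have "real (card (H z)) * (Q - 1) = Q ^ Suc m - 1" using Q by (simp only: mult_cancel_left) auto
    thus ?thesis using Suc.hyps(2) by (simp add: H_def Q_def)
  qed
qed

text \<open>
  The diamond property of a modular lattice.
\<close>

lemma covers_plus_iff:
  assumes "subspace u" "subspace v"
  shows "covers scale (u + v) u \<longleftrightarrow> covers scale v (u \<inter> v)"
  using dim_plus_inter[OF assms] le_plus[OF assms] by (auto simp: covers_def)

lemma common_cover_eq_plus:
  assumes "subspace u" "subspace v" "subspace w" "u \<noteq> v" "covers scale w u" "covers scale w v"
  shows "w = u + v"
proof (rule sym, rule subspace_eqI)
  have "\<not> v \<subseteq> u" using assms subspace_eqI[of v u] by (auto simp: covers_def)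
  hence "u \<subset> u + v" using le_plus[of u v] assms by auto
  hence "dim u < dim (u + v)" by (intro dim_psubset) (use assms in \<open>simp add: span_eq_iff[THEN iffD2] subspace_plus\<close>)
  thus "dim w \<le> dim (u + v)" using assms by (simp add: covers_def)
  show "u + v \<subseteq> w" using assms by (intro plus_le) (auto simp: covers_def)
qed (use assms in \<open>auto simp: subspace_plus\<close>)

lemma commonly_covered_eq_inter:
  assumes "subspace u" "subspace v" "subspace w" "u \<noteq> v" "covers scale u w" "covers scale v w"
  shows "w = u \<inter> v"
proof (rule subspace_eqI)
  have "\<not> u \<subseteq> v" using assms subspace_eqI[of u v] by (auto simp: covers_def)
  hence "u \<inter> v \<subset> u" by auto
  hence "dim (u \<inter> v) < dim u" by (intro dim_psubset) (use assms in \<open>simp add: span_eq_iff[THEN iffD2] subspace_inter\<close>)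
  thus "dim (u \<inter> v) \<le> dim w" using assms by (simp add: covers_def)
  show "w \<subseteq> u \<inter> v" using assms by (auto simp: covers_def)
qed (use assms in \<open>auto simp: subspace_inter\<close>)

text \<open>
  The dimension of \<open>w \<inter> S\<close> is a supermodular function of \<open>w\<close>.  This rules out the squares whose sides
  all gain a dimension in \<open>S\<close> at the bottom and none at the top.
\<close>

lemma dim_inter_square:
  assumes "subspace u" "subspace v" "subspace S"
  shows "dim (u \<inter> S) + dim (v \<inter> S) \<le> dim ((u + v) \<inter> S) + dim (u \<inter> v \<inter> S)"
proof -
  have "dim ((u \<inter> S) + (v \<inter> S)) + dim ((u \<inter> S) \<inter> (v \<inter> S)) = dim (u \<inter> S) + dim (v \<inter> S)"
    using assms by (intro dim_plus_inter subspace_inter)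
  moreover have "(u \<inter> S) \<inter> (v \<inter> S) = u \<inter> v \<inter> S" by auto
  moreover have "dim ((u \<inter> S) + (v \<inter> S)) \<le> dim ((u + v) \<inter> S)"
    using assms by (intro dim_subset) (auto simp: set_plus_def intro: subspace_add)
  ultimately show ?thesis by simp
qed

text \<open>
  The middle elements of the interval from \<open>z\<close> to \<open>x\<close> are \<open>q + 1\<close> in number.  The only one that gains a
  dimension inside \<open>y\<close> already in the first step is \<open>z + (x \<inter> y)\<close>, and the other \<open>q\<close> gain it in the second.
\<close>

lemma card_backslash_slash_interval:
  assumes z: "subspace z" and x: "subspace x" and y: "subspace y"
  shows "card {w. subspace w \<and> backslash_covers scale y w z \<and> slash_covers scale y x w}
     = CARD('f) * card {w. subspace w \<and> slash_covers scale y w z \<and> backslash_covers scale y x w}"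
    (is "card ?B = _ * card ?S")
proof (cases "z \<subseteq> x \<and> dim x = dim z + 2 \<and> dim (x \<inter> y) = dim (z \<inter> y) + 1")
  case False
  hence "?B = {}" "?S = {}" by (auto simp: slash_covers_def backslash_covers_def covers_def)
  thus ?thesis by (simp only: card.empty mult_0_right)
next
  case True
  define w0 where "w0 = z + (x \<inter> y)"
  have w0: "subspace w0" "z \<subseteq> w0" "x \<inter> y \<subseteq> w0" "w0 \<subseteq> x"
    unfolding w0_def using True
    by (intro subspace_plus z le_plus plus_le x y subspace_inter; blast)+
  have "z \<inter> (x \<inter> y) = z \<inter> y" using True by auto
  hence dw0: "dim w0 = dim z + 1" using dim_plus_inter[of z "x \<inter> y"] z x y True by (simp add: w0_def subspace_inter)
  have "?S = {w0}"
  proof (rule set_eqI, rule iffI)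
    fix w assume "w \<in> ?S"
    hence w: "subspace w" "w \<subseteq> x" "z \<subseteq> w" "dim w = dim z + 1" "dim (w \<inter> y) = dim (x \<inter> y)"
      by (auto simp: slash_covers_def backslash_covers_def covers_def)
    hence "w \<inter> y = x \<inter> y" using x y by (intro subspace_eqI subspace_inter) auto
    hence "w0 \<subseteq> w" unfolding w0_def using w by (intro plus_le) auto
    hence "w0 = w" using w w0 dw0 by (intro subspace_eqI) auto
    thus "w \<in> {w0}" by simp
  next
    fix w assume "w \<in> {w0}"
    moreover have "w0 \<inter> y = x \<inter> y" using w0 by auto
    ultimately show "w \<in> ?S" using w0 dw0 True by (auto simp: slash_covers_def backslash_covers_def covers_def)
  qed
  hence S: "card ?S = 1" by simp
  have "{w. subspace w \<and> z \<subseteq> w \<and> covers scale x w} = ?B \<union> ?S"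
  proof (rule set_eqI, rule iffI)
    fix w assume "w \<in> {w. subspace w \<and> z \<subseteq> w \<and> covers scale x w}"
    hence w: "subspace w" "covers scale x w" "covers scale w z" using True by (auto simp: covers_def)
    show "w \<in> ?B \<union> ?S" using w True dim_inter_cover[OF z w(1) y w(3)] dim_inter_cover[OF w(1) x y w(2)]
      by (auto simp: slash_covers_def backslash_covers_def)
  qed (auto simp: slash_covers_def backslash_covers_def covers_def)
  moreover have "?B \<inter> ?S = {}" by (auto simp: slash_covers_def backslash_covers_def)
  ultimately have "card {w. subspace w \<and> z \<subseteq> w \<and> covers scale x w} = card ?B + 1"
    using S by (simp add: card_Un_disjoint)
  hence "(real (card ?B) + 1) * (real CARD('f) - 1) = real CARD('f) ^ 2 - 1"
    using card_hyperplanes[OF z x] True by (simp add: add_ac)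
  hence "(real (card ?B) - real CARD('f)) * (real CARD('f) - 1) = 0"
    by (simp add: algebra_simps power2_eq_square)
  hence "card ?B = CARD('f)" using q_gt_1 by simp
  with S show ?thesis by simp
qed

context
  fixes u y assumes u: "subspace u" and y: "subspace y"
begin

lemma card_slash_covers:
  "real (card {w. subspace w \<and> slash_covers scale y w u}) * (real CARD('f) - 1) = real CARD('f) ^ (dim y - dim (u \<inter> y)) - 1"
  using card_covers[OF u y] by (simp add: slash_covers_def)

lemma card_backslash_covers:
  "real (card {w. subspace w \<and> backslash_covers scale y w u}) * (real CARD('f) - 1)
     = real CARD('f) ^ (dim (UNIV :: 'v set) - dim u) - real CARD('f) ^ (dim y - dim (u \<inter> y))"
proof -
  let ?S = "{w. subspace w \<and> slash_covers scale y w u}" and ?B = "{w. subspace w \<and> backslash_covers scale y w u}"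
  have "{w. subspace w \<and> covers scale w u \<and> dim (w \<inter> UNIV) = dim (u \<inter> UNIV) + 1} = ?S \<union> ?B"
    using covers_cases[OF u _ y] by (auto simp: slash_covers_def backslash_covers_def covers_def)
  moreover have "?S \<inter> ?B = {}" by (auto simp: slash_covers_def backslash_covers_def)
  ultimately have "real (card ?S + card ?B) * (real CARD('f) - 1) = real CARD('f) ^ (dim (UNIV :: 'v set) - dim u) - 1"
    using card_covers[OF u subspace_UNIV] by (simp add: card_Un_disjoint)
  with card_slash_covers show ?thesis by (simp add: algebra_simps)
qed

text \<open>
  A hyperplane \<open>w\<close> of \<open>u\<close> has \<open>dim (w \<inter> y) = dim (u \<inter> y)\<close> precisely if it contains \<open>u \<inter> y\<close>.
\<close>

lemma card_backslash_covered:
  "real (card {w. subspace w \<and> backslash_covers scale y u w}) * (real CARD('f) - 1) = real CARD('f) ^ (dim u - dim (u \<inter> y)) - 1"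
proof -
  have "u \<inter> y \<subseteq> w \<longleftrightarrow> dim (u \<inter> y) = dim (w \<inter> y)" if "subspace w" "covers scale u w" for w
  proof
    assume "u \<inter> y \<subseteq> w"
    hence "u \<inter> y = w \<inter> y" using that by (auto simp: covers_def)
    thus "dim (u \<inter> y) = dim (w \<inter> y)" by simp
  next
    assume "dim (u \<inter> y) = dim (w \<inter> y)"
    hence "w \<inter> y = u \<inter> y" using that u y by (intro subspace_eqI) (auto simp: subspace_inter covers_def)
    thus "u \<inter> y \<subseteq> w" by auto
  qed
  hence "{w. subspace w \<and> backslash_covers scale y u w} = {w. subspace w \<and> u \<inter> y \<subseteq> w \<and> covers scale u w}"
    by (auto simp: backslash_covers_def)
  thus ?thesis using card_hyperplanes[of "u \<inter> y" u] u y by (simp add: subspace_inter)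
qed

lemma card_slash_covered:
  "real (card {w. subspace w \<and> slash_covers scale y u w}) * (real CARD('f) - 1)
     = real CARD('f) ^ dim u - real CARD('f) ^ (dim u - dim (u \<inter> y))"
proof -
  let ?S = "{w. subspace w \<and> slash_covers scale y u w}" and ?B = "{w. subspace w \<and> backslash_covers scale y u w}"
  have "{w. subspace w \<and> {0} \<subseteq> w \<and> covers scale u w} = ?S \<union> ?B"
    using covers_cases[OF _ u y] by (auto simp: slash_covers_def backslash_covers_def subspace_0)
  moreover have "?S \<inter> ?B = {}" by (auto simp: slash_covers_def backslash_covers_def)
  ultimately have "real (card ?S + card ?B) * (real CARD('f) - 1) = real CARD('f) ^ dim u - 1"
    using card_hyperplanes[of "{0}" u] u by (simp add: card_Un_disjoint subspace_0)
  with card_backslash_covered show ?thesis by (simp add: algebra_simps)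
qed

end

end

section \<open>Squares of covers and the three kinds of adjacency\<close>

context finite_space
begin

definition "square u v \<longleftrightarrow> u \<noteq> v \<and> covers scale (u + v) u \<and> covers scale (u + v) v"

text \<open>
  The relations behind the matrices \<open>F\<^sup>0\<close>, \<open>F\<^sup>+\<close> and \<open>F\<^sup>-\<close>, stated for subspaces instead of their indices.
\<close>

definition "F0_rel y u v \<longleftrightarrow> slash_covers scale y (u + v) u \<and> slash_covers scale y (u + v) v \<and>
     backslash_covers scale y u (u \<inter> v) \<and> backslash_covers scale y v (u \<inter> v)"
definition "Fplus_rel y u v \<longleftrightarrow> backslash_covers scale y (u + v) u \<and> backslash_covers scale y (u + v) v"
definition "Fminus_rel y u v \<longleftrightarrow> slash_covers scale y u (u \<inter> v) \<and> slash_covers scale y v (u \<inter> v)"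

context
  fixes u v y assumes u: "subspace u" and v: "subspace v" and y: "subspace y"
begin

lemma square_iff: "square u v \<longleftrightarrow> u \<noteq> v \<and> covers scale u (u \<inter> v) \<and> covers scale v (u \<inter> v)"
  using covers_plus_iff[OF u v] covers_plus_iff[OF v u]
  by (auto simp: square_def add.commute[of v u] Int_commute[of v u])

lemma not_covers_self: "\<not> covers scale u u" by (simp add: covers_def)

lemma square_dims:
  assumes "square u v"
  defines "i \<equiv> \<lambda>w. dim (w \<inter> y)"
  shows "i (u \<inter> v) \<le> i u" "i u \<le> i (u \<inter> v) + 1" "i (u \<inter> v) \<le> i v" "i v \<le> i (u \<inter> v) + 1"
    "i u \<le> i (u + v)" "i (u + v) \<le> i u + 1" "i v \<le> i (u + v)" "i (u + v) \<le> i v + 1"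
    "i u + i v \<le> i (u + v) + i (u \<inter> v)"
proof -
  have up: "covers scale (u + v) u" "covers scale (u + v) v" using assms(1) by (auto simp: square_def)
  have down: "covers scale u (u \<inter> v)" "covers scale v (u \<inter> v)" using assms(1) square_iff by auto
  show "i (u \<inter> v) \<le> i u" "i u \<le> i (u \<inter> v) + 1" "i (u \<inter> v) \<le> i v" "i v \<le> i (u \<inter> v) + 1"
    "i u \<le> i (u + v)" "i (u + v) \<le> i u + 1" "i v \<le> i (u + v)" "i (u + v) \<le> i v + 1"
    unfolding i_def
    by (rule dim_inter_cover[OF subspace_inter[OF u v] u y down(1)] dim_inter_cover[OF subspace_inter[OF u v] v y down(2)]
          dim_inter_cover[OF u subspace_plus[OF u v] y up(1)] dim_inter_cover[OF v subspace_plus[OF u v] y up(2)])+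
  show "i u + i v \<le> i (u + v) + i (u \<inter> v)" unfolding i_def by (rule dim_inter_square[OF u v y])
qed

text \<open>
  Distinct \<open>u\<close> and \<open>v\<close> have at most one common cover, namely \<open>u + v\<close>.  This and the dual statement turn
  the sums in the products of cover matrices into a single term.
\<close>

lemma above_both:
  assumes "u \<noteq> v"
  shows "{w. subspace w \<and> (covers scale w u \<and> P w) \<and> (covers scale w v \<and> Q w)}
    = (if square u v \<and> P (u + v) \<and> Q (u + v) then {u + v} else {})"
proof -
  have *: "subspace w \<and> covers scale w u \<and> covers scale w v \<longleftrightarrow> square u v \<and> w = u + v" for w
    using common_cover_eq_plus[OF u v _ assms, of w] subspace_plus[OF u v] assms unfolding square_def by blast
  have "{w. subspace w \<and> (covers scale w u \<and> P w) \<and> (covers scale w v \<and> Q w)}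
    = {w. (subspace w \<and> covers scale w u \<and> covers scale w v) \<and> P w \<and> Q w}" by blast
  thus ?thesis unfolding * by auto
qed

lemma below_both:
  assumes "u \<noteq> v"
  shows "{w. subspace w \<and> (covers scale u w \<and> P w) \<and> (covers scale v w \<and> Q w)}
    = (if square u v \<and> P (u \<inter> v) \<and> Q (u \<inter> v) then {u \<inter> v} else {})"
proof -
  have *: "subspace w \<and> covers scale u w \<and> covers scale v w \<longleftrightarrow> square u v \<and> w = u \<inter> v" for w
    using commonly_covered_eq_inter[OF u v _ assms, of w] subspace_inter[OF u v] assms unfolding square_iff by blast
  have "{w. subspace w \<and> (covers scale u w \<and> P w) \<and> (covers scale v w \<and> Q w)}
    = {w. (subspace w \<and> covers scale u w \<and> covers scale v w) \<and> P w \<and> Q w}" by blast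
  thus ?thesis unfolding * by auto
qed

text \<open>
  All three relations live on squares and require \<open>u\<close> and \<open>v\<close> to have the same level; they differ in
  where \<open>dim (w \<inter> y)\<close> jumps along the square: at the top for \<open>F\<^sup>0\<close>, nowhere for \<open>F\<^sup>+\<close>, and at the bottom
  (by supermodularity then also at the top) for \<open>F\<^sup>-\<close>.
\<close>

lemma rel_square:
  "F0_rel y u v \<longleftrightarrow> square u v \<and> dim (u \<inter> y) = dim (v \<inter> y)
      \<and> dim ((u + v) \<inter> y) = dim (u \<inter> y) + 1 \<and> dim (u \<inter> v \<inter> y) = dim (u \<inter> y)"
  "Fplus_rel y u v \<longleftrightarrow> square u v \<and> dim (u \<inter> y) = dim (v \<inter> y)
      \<and> dim ((u + v) \<inter> y) = dim (u \<inter> y)"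
  "Fminus_rel y u v \<longleftrightarrow> square u v \<and> dim (u \<inter> y) = dim (v \<inter> y)
      \<and> dim (u \<inter> v \<inter> y) + 1 = dim (u \<inter> y)"
proof -
  have "u + u = u" using le_plus[OF u u] plus_le[OF u subset_refl subset_refl] by blast
  hence self: "\<not> covers scale (u + v) u" "\<not> covers scale u (u \<inter> v)" if "u = v"
    using that by (simp_all add: covers_def)
  have e: "covers scale (u + v) u \<longleftrightarrow> covers scale v (u \<inter> v)" "covers scale (u + v) v \<longleftrightarrow> covers scale u (u \<inter> v)"
    using covers_plus_iff[OF u v] covers_plus_iff[OF v u] by (simp_all add: add.commute Int_commute)
  have sq: "square u v \<longleftrightarrow> covers scale u (u \<inter> v) \<and> covers scale v (u \<inter> v)" using square_iff self by blast
  show "F0_rel y u v \<longleftrightarrow> square u v \<and> dim (u \<inter> y) = dim (v \<inter> y)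
      \<and> dim ((u + v) \<inter> y) = dim (u \<inter> y) + 1 \<and> dim (u \<inter> v \<inter> y) = dim (u \<inter> y)"
    unfolding F0_rel_def slash_covers_def backslash_covers_def e sq by auto
  show "Fplus_rel y u v \<longleftrightarrow> square u v \<and> dim (u \<inter> y) = dim (v \<inter> y)
      \<and> dim ((u + v) \<inter> y) = dim (u \<inter> y)"
    unfolding Fplus_rel_def backslash_covers_def e sq by auto
  show "Fminus_rel y u v \<longleftrightarrow> square u v \<and> dim (u \<inter> y) = dim (v \<inter> y)
      \<and> dim (u \<inter> v \<inter> y) + 1 = dim (u \<inter> y)"
    unfolding Fminus_rel_def slash_covers_def e sq by auto
qed

text \<open>
  Adjacency splits into five disjoint cases: \<open>u\<close> and \<open>v\<close> have the same level and are related by one of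
  the three relations, or the dimension of the intersection with \<open>y\<close> changes by one.
\<close>

lemma adjacent_cases:
  "of_bool (covers scale u (u \<inter> v) \<and> covers scale v (u \<inter> v))
   = (of_bool (F0_rel y u v) + of_bool (Fplus_rel y u v) + of_bool (Fminus_rel y u v)
     + of_bool (square u v \<and> dim (v \<inter> y) = dim (u \<inter> y) + 1)
     + of_bool (square u v \<and> dim (u \<inter> y) = dim (v \<inter> y) + 1) :: complex)"
proof (cases "square u v")
  case True
  hence "covers scale u (u \<inter> v)" "covers scale v (u \<inter> v)" using square_iff by auto
  moreover define a b c s where "a = dim (u \<inter> y)" "b = dim (v \<inter> y)" "c = dim (u \<inter> v \<inter> y)" "s = dim ((u + v) \<inter> y)"
  note d = square_dims[OF True, folded this]
  have "of_bool (a = b \<and> s = a + 1 \<and> c = a) + of_bool (a = b \<and> s = a) + of_bool (a = b \<and> c + 1 = a)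
     + of_bool (b = a + 1) + of_bool (a = b + 1) = (1 :: complex)"
    using d by (cases "a = c"; cases "b = c"; cases "s = a") auto
  ultimately show ?thesis using True unfolding rel_square \<open>a = _\<close> \<open>b = _\<close> \<open>c = _\<close> \<open>s = _\<close> by simp
next
  case False
  hence "\<not> (covers scale u (u \<inter> v) \<and> covers scale v (u \<inter> v))" using not_covers_self unfolding square_iff by auto
  with False show ?thesis unfolding rel_square by auto
qed

lemma card_slash_slash_above:
  "card {w. subspace w \<and> slash_covers scale y w u \<and> slash_covers scale y w v}
     = of_bool (F0_rel y u v) + of_bool (Fminus_rel y u v)"
  if "u \<noteq> v"
proof (cases "square u v")
  case True
  show ?thesis unfolding slash_covers_def rel_square above_both[OF that] below_both[OF that]
    using True square_dims[OF True] by auto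
next
  case False
  thus ?thesis unfolding slash_covers_def rel_square above_both[OF that] below_both[OF that] by auto
qed

lemma card_slash_slash_below:
  "card {w. subspace w \<and> slash_covers scale y u w \<and> slash_covers scale y v w}
     = of_bool (Fminus_rel y u v)"
  if "u \<noteq> v"
proof (cases "square u v")
  case True
  show ?thesis unfolding slash_covers_def rel_square above_both[OF that] below_both[OF that]
    using True square_dims[OF True] by auto
next
  case False
  thus ?thesis unfolding slash_covers_def rel_square above_both[OF that] below_both[OF that] by auto
qed

lemma card_backslash_backslash_above:
  "card {w. subspace w \<and> backslash_covers scale y w u \<and> backslash_covers scale y w v}
     = of_bool (Fplus_rel y u v)"
  if "u \<noteq> v"
proof (cases "square u v")
  case True
  show ?thesis unfolding backslash_covers_def rel_square above_both[OF that] below_both[OF that]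
    using True square_dims[OF True] by auto
next
  case False
  thus ?thesis unfolding backslash_covers_def rel_square above_both[OF that] below_both[OF that] by auto
qed

lemma card_backslash_backslash_below:
  "card {w. subspace w \<and> backslash_covers scale y u w \<and> backslash_covers scale y v w}
     = of_bool (F0_rel y u v) + of_bool (Fplus_rel y u v)"
  if "u \<noteq> v"
proof (cases "square u v")
  case True
  show ?thesis unfolding backslash_covers_def rel_square above_both[OF that] below_both[OF that]
    using True square_dims[OF True] by auto
next
  case False
  thus ?thesis unfolding backslash_covers_def rel_square above_both[OF that] below_both[OF that] by auto
qed

lemma card_slash_backslash_above:
  "card {w. subspace w \<and> slash_covers scale y w u \<and> backslash_covers scale y w v}
     = of_bool (square u v \<and> dim (v \<inter> y) = dim (u \<inter> y) + 1)"
proof (cases "u = v")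
  case True
  then show ?thesis by (auto simp: slash_covers_def backslash_covers_def square_def)
next
  case False
  show ?thesis
  proof (cases "square u v")
    case True
    show ?thesis unfolding slash_covers_def backslash_covers_def above_both[OF False]
      using True square_dims[OF True] by auto
  next
    case False': False
    thus ?thesis unfolding slash_covers_def backslash_covers_def above_both[OF False] by auto
  qed
qed

lemma card_backslash_slash_below:
  "card {w. subspace w \<and> backslash_covers scale y u w \<and> slash_covers scale y v w}
     = of_bool (square u v \<and> dim (v \<inter> y) = dim (u \<inter> y) + 1)"
proof (cases "u = v")
  case True
  then show ?thesis by (auto simp: slash_covers_def backslash_covers_def square_def)
next
  case False
  show ?thesis
  proof (cases "square u v")
    case True
    show ?thesis unfolding slash_covers_def backslash_covers_def below_both[OF False]
      using True square_dims[OF True] by auto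
  next
    case False': False
    thus ?thesis unfolding slash_covers_def backslash_covers_def below_both[OF False] by auto
  qed
qed

end

end

lemma zero_one_mult_nth:
  "(zero_one_mat R ** zero_one_mat S) $ u $ v = of_nat (card {w. R u w \<and> S w v})"
proof -
  have "(zero_one_mat R ** zero_one_mat S) $ u $ v = (\<Sum>w\<in>UNIV. if R u w \<and> S w v then 1 else 0)"
    unfolding matrix_matrix_mult_def zero_one_mat_def by (auto intro!: sum.cong)
  thus ?thesis by (simp add: sum.If_cases)
qed

section \<open>Matrices graded by the level of a subspace\<close>

text \<open>
  The arguments of \<open>g\<close> are the values \<open>a u = q\<^sup>i\<close> and \<open>b u = q\<^sup>j\<close> instead of \<open>i\<close> and \<open>j\<close>: a change of
  level is then a rescaling of the arguments, and identities between diagonals are identities of rational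
  functions.
\<close>

definition level_diag :: "('p::finite \<Rightarrow> 'c::field) \<Rightarrow> ('p \<Rightarrow> 'c) \<Rightarrow> ('c \<Rightarrow> 'c \<Rightarrow> 'c) \<Rightarrow> 'c ^ 'p ^ 'p" where
  "level_diag a b g = (\<chi> u v. if u = v then g (a u) (b u) else 0)"

text \<open>
  Graded matrices are those past which a level diagonal can be moved, by rescaling its arguments with \<open>s\<close>
  and \<open>t\<close>; the factors multiply in products.
\<close>

definition graded :: "('p::finite \<Rightarrow> 'c::field) \<Rightarrow> ('p \<Rightarrow> 'c) \<Rightarrow> 'c \<Rightarrow> 'c \<Rightarrow> 'c ^ 'p ^ 'p \<Rightarrow> bool" where
  "graded a b s t M \<longleftrightarrow> (\<forall>u v. M $ u $ v \<noteq> 0 \<longrightarrow> a v = s * a u \<and> b v = t * b u)"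

lemma level_diag_mult_nth:
  "(level_diag a b g ** M) $ u $ v = g (a u) (b u) * M $ u $ v"
  by (simp add: matrix_matrix_mult_def level_diag_def mult_delta_left)

lemma mult_level_diag_nth:
  "(M ** level_diag a b g) $ u $ v = M $ u $ v * g (a v) (b v)"
  by (simp add: matrix_matrix_mult_def level_diag_def mult_delta_right)

lemma level_diag_nth: "level_diag a b g $ u $ v = g (a u) (b u) * mat 1 $ u $ v"
  by (simp add: level_diag_def mat_def)

lemma level_diag_mult_level_diag:
  "level_diag a b f ** level_diag a b g = level_diag a b (\<lambda>x y. f x y * g x y)"
  by (simp add: vec_eq_iff level_diag_mult_nth level_diag_nth)

lemma matrix_inv_level_diag:
  assumes "\<And>u. g (a u) (b u) \<noteq> 0"
  shows "matrix_inv (level_diag a b g) = level_diag a b (\<lambda>x y. 1 / g x y)"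
proof -
  let ?A = "level_diag a b g" and ?B = "level_diag a b (\<lambda>x y. 1 / g x y)"
  have inv: "?A ** ?B = mat 1 \<and> ?B ** ?A = mat 1"
    unfolding level_diag_mult_level_diag using assms by (simp add: level_diag_def mat_def vec_eq_iff)
  have "?A ** matrix_inv ?A = mat 1 \<and> matrix_inv ?A ** ?A = mat 1"
    unfolding matrix_inv_def by (rule someI[of _ ?B]) (rule inv)
  hence "matrix_inv ?A = (?B ** ?A) ** matrix_inv ?A" using inv by simp
  also have "\<dots> = ?B" using \<open>?A ** matrix_inv ?A = mat 1 \<and> _\<close> by (simp flip: matrix_mul_assoc)
  finally show ?thesis .
qed

lemma matrix_diff_ldistrib:
  fixes A :: "'c::ring_1 ^ 'n ^ 'm"
  shows "A ** (B - C) = A ** B - A ** C"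
  by (simp add: matrix_matrix_mult_def vec_eq_iff right_diff_distrib sum_subtractf)

lemma matrix_diff_rdistrib:
  fixes A B :: "'c::ring_1 ^ 'n ^ 'm"
  shows "(A - B) ** C = A ** C - B ** C"
  by (simp add: matrix_matrix_mult_def vec_eq_iff left_diff_distrib sum_subtractf)

lemma matrix_add_rdistrib:
  fixes A B :: "'c::ring_1 ^ 'n ^ 'm"
  shows "(A + B) ** C = A ** C + B ** C"
  by (simp add: matrix_matrix_mult_def vec_eq_iff distrib_right sum.distrib)

lemma graded_mult_level_diag:
  assumes "graded a b s t M"
  shows "M ** level_diag a b g = level_diag a b (\<lambda>x y. g (s * x) (t * y)) ** M"
proof -
  have "M $ u $ v * g (a v) (b v) = g (s * a u) (t * b u) * M $ u $ v" for u v
    using assms unfolding graded_def by (cases "M $ u $ v = 0") auto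
  thus ?thesis by (simp add: vec_eq_iff level_diag_mult_nth mult_level_diag_nth)
qed

text \<open>
  The numbers of slash and backslash covers above and below a subspace of level \<open>(i, j)\<close>, as functions of
  \<open>x = q\<^sup>i\<close> and \<open>y = q\<^sup>j\<close>, with \<open>\<alpha> = q\<^sup>k\<close> and \<open>\<beta> = q\<^sup>h\<close>.
\<close>

definition slash_up :: "'c::field \<Rightarrow> 'c \<Rightarrow> 'c \<Rightarrow> 'c \<Rightarrow> 'c" where
  "slash_up q \<alpha> x y = (\<alpha> / x - 1) / (q - 1)"

definition slash_down :: "'c::field \<Rightarrow> 'c \<Rightarrow> 'c \<Rightarrow> 'c" where
  "slash_down q x y = y * (x - 1) / (q - 1)"

definition backslash_up :: "'c::field \<Rightarrow> 'c \<Rightarrow> 'c \<Rightarrow> 'c \<Rightarrow> 'c \<Rightarrow> 'c" where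
  "backslash_up q \<alpha> \<beta> x y = \<alpha> / x * (\<beta> / y - 1) / (q - 1)"

definition backslash_down :: "'c::field \<Rightarrow> 'c \<Rightarrow> 'c \<Rightarrow> 'c" where
  "backslash_down q x y = (y - 1) / (q - 1)"

lemma graded_add:
  "graded a b s t M \<Longrightarrow> graded a b s t N \<Longrightarrow> graded a b s t (M + N)"
  unfolding graded_def by (metis add.right_neutral vector_add_component)

lemma graded_mult:
  assumes "graded a b s t M" "graded a b s' t' N" "s'' = s * s'" "t'' = t * t'"
  shows "graded a b s'' t'' (M ** N)"
  unfolding graded_def
proof (intro allI impI)
  fix u v assume "(M ** N) $ u $ v \<noteq> 0"
  then obtain k where "M $ u $ k * N $ k $ v \<noteq> 0"
    unfolding matrix_matrix_mult_def by (auto elim: sum.not_neutral_contains_not_neutral)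
  hence "M $ u $ k \<noteq> 0" "N $ k $ v \<noteq> 0" by auto
  with assms show "a v = s'' * a u \<and> b v = t'' * b u"
    unfolding graded_def by (metis mult.assoc mult.commute)
qed

section \<open>The algebra generated by the cover matrices\<close>

text \<open>
  What the proof uses about the cover matrices.  Over any field these relations alone imply the two relations
  between \<open>A\<close> and \<open>A*\<close>.
\<close>

locale cover_algebra =
  fixes q \<alpha> \<beta> :: "'c::field" and a b :: "'p::finite \<Rightarrow> 'c"
    and L1 L2 R1 R2 F0 Fp Fm :: "'c ^ 'p ^ 'p"
  assumes nonzero: "q \<noteq> 0" "q \<noteq> 1" "\<alpha> \<noteq> 0" "\<beta> \<noteq> 0" "a u \<noteq> 0" "b u \<noteq> 0"
    and graded: "graded a b q 1 L1" "graded a b 1 q L2"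
       "graded a b (inverse q) 1 R1" "graded a b 1 (inverse q) R2" "graded a b 1 1 F0" "graded a b 1 1 Fp" "graded a b 1 1 Fm"
    and L2L1: "L2 ** L1 = level_diag a b (\<lambda>_ _. q) ** (L1 ** L2)"
    and R1R2: "R1 ** R2 = level_diag a b (\<lambda>_ _. q) ** (R2 ** R1)"
    and R2L1: "R2 ** L1 = L1 ** R2"
    and R1L2: "R1 ** L2 = L2 ** R1"
    and L1R1: "L1 ** R1 = F0 + Fm + level_diag a b (slash_up q \<alpha>)"
    and R1L1: "R1 ** L1 = Fm + level_diag a b (slash_down q)"
    and L2R2: "L2 ** R2 = Fp + level_diag a b (backslash_up q \<alpha> \<beta>)"
    and R2L2: "R2 ** L2 = F0 + Fp + level_diag a b (backslash_down q)"
begin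

abbreviation D where "D \<equiv> level_diag a b"

definition slash_excess where "slash_excess x y = slash_up q \<alpha> x y - slash_down q x y"
definition backslash_excess where "backslash_excess x y = backslash_down q x y - backslash_up q \<alpha> \<beta> x y"

lemmas count_defs = slash_up_def slash_down_def backslash_up_def backslash_down_def

lemmas distrib = matrix_add_ldistrib matrix_add_rdistrib matrix_diff_ldistrib matrix_diff_rdistrib

text \<open>
  Words are kept associated to the right, so a rule for \<open>A ** B\<close> is also needed in the middle of a word.
\<close>

lemma mult_tail: "A ** B = C \<Longrightarrow> A ** (B ** M) = C ** M" for A B C M :: "'c ^ 'p ^ 'p"
  by (simp add: matrix_mul_assoc)

lemmas shift = graded[THEN graded_mult_level_diag]
lemmas diag = level_diag_mult_level_diag level_diag_mult_level_diag[THEN mult_tail] shift shift[THEN mult_tail]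

lemma q_minus_1: "q - 1 \<noteq> 0" using nonzero by simp

lemma F0_slash: "F0 = L1 ** R1 - R1 ** L1 - D slash_excess"
  unfolding L1R1 R1L1 by (simp add: vec_eq_iff level_diag_nth slash_excess_def algebra_simps)

lemma F0_backslash: "F0 = R2 ** L2 - L2 ** R2 - D backslash_excess"
  unfolding L2R2 R2L2 by (simp add: vec_eq_iff level_diag_nth backslash_excess_def algebra_simps)

lemma Fp_L2R2: "Fp = L2 ** R2 - D (backslash_up q \<alpha> \<beta>)"
  unfolding L2R2 by simp
lemma Fm_L1R1: "Fm = L1 ** R1 - F0 - D (slash_up q \<alpha>)"
  unfolding L1R1 by simp

lemma R1L1': "R1 ** L1 = L1 ** R1 - F0 - D slash_excess" by (subst F0_slash) simp
lemma R2L2': "R2 ** L2 = L2 ** R2 + F0 + D backslash_excess" by (subst F0_backslash) simp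

lemmas entries = level_diag_mult_nth level_diag_nth

text \<open>
  The commutator \<open>R2 L2 - L2 R2\<close> is the right expression for \<open>F0\<close> here: its letters commute or
  \<open>q\<close>-commute with \<open>L1\<close>, so \<open>L1\<close> passes through both of its terms with the same factor \<open>q\<close>.
\<close>

lemma F0L1: "F0 ** L1 = D (\<lambda>_ _. q) ** (L1 ** F0) + D (\<lambda>x y. q * backslash_excess (q * x) y - backslash_excess x y) ** L1"
proof -
  have "F0 ** L1 = (R2 ** L2 - L2 ** R2 - D backslash_excess) ** L1" by (simp flip: F0_backslash)
  also have "\<dots> = D (\<lambda>_ _. q) ** (L1 ** (R2 ** L2 - L2 ** R2 - D backslash_excess))
      + D (\<lambda>x y. q * backslash_excess (q * x) y - backslash_excess x y) ** L1"
    by (simp add: distrib matrix_mul_assoc[symmetric] diag L2L1 L2L1[THEN mult_tail] R2L1 R2L1[THEN mult_tail])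
     (simp add: vec_eq_iff entries algebra_simps)
  also have "\<dots> = D (\<lambda>_ _. q) ** (L1 ** F0)
      + D (\<lambda>x y. q * backslash_excess (q * x) y - backslash_excess x y) ** L1"
    by (simp flip: F0_backslash)
  finally show ?thesis .
qed

lemma L1L2: "L1 ** L2 = D (\<lambda>_ _. inverse q) ** (L2 ** L1)"
  by (simp add: L2L1 diag nonzero vec_eq_iff entries)

lemma R2R1: "R2 ** R1 = D (\<lambda>_ _. inverse q) ** (R1 ** R2)"
  by (simp add: R1R2 diag nonzero vec_eq_iff entries)

text \<open>
  For \<open>L2\<close> and \<open>R2\<close> the other commutator \<open>L1 R1 - R1 L1\<close> has this property.
\<close>

lemma F0L2: "F0 ** L2 = D (\<lambda>_ _. inverse q) ** (L2 ** F0)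
    + D (\<lambda>x y. inverse q * slash_excess x (q * y) - slash_excess x y) ** L2"
proof -
  have "F0 ** L2 = (L1 ** R1 - R1 ** L1 - D slash_excess) ** L2" by (simp flip: F0_slash)
  also have "\<dots> = D (\<lambda>_ _. inverse q) ** (L2 ** (L1 ** R1 - R1 ** L1 - D slash_excess))
      + D (\<lambda>x y. inverse q * slash_excess x (q * y) - slash_excess x y) ** L2"
    by (simp add: distrib matrix_mul_assoc[symmetric] diag L1L2 L1L2[THEN mult_tail] R1L2 R1L2[THEN mult_tail])
     (simp add: vec_eq_iff entries algebra_simps)
  also have "\<dots> = D (\<lambda>_ _. inverse q) ** (L2 ** F0)
      + D (\<lambda>x y. inverse q * slash_excess x (q * y) - slash_excess x y) ** L2"
    by (simp flip: F0_slash)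
  finally show ?thesis .
qed

lemma R1F0: "R1 ** F0 = D (\<lambda>_ _. q) ** (F0 ** R1) + D (\<lambda>x y. q * backslash_excess x y - backslash_excess (inverse q * x) y) ** R1"
proof -
  have "R1 ** F0 = R1 ** (R2 ** L2 - L2 ** R2 - D backslash_excess)" by (simp flip: F0_backslash)
  also have "\<dots> = D (\<lambda>_ _. q) ** ((R2 ** L2 - L2 ** R2 - D backslash_excess) ** R1)
      + D (\<lambda>x y. q * backslash_excess x y - backslash_excess (inverse q * x) y) ** R1"
    by (simp add: distrib matrix_mul_assoc[symmetric] diag R1R2 R1R2[THEN mult_tail] R1L2 R1L2[THEN mult_tail])
     (simp add: vec_eq_iff entries algebra_simps)
  also have "\<dots> = D (\<lambda>_ _. q) ** (F0 ** R1)
      + D (\<lambda>x y. q * backslash_excess x y - backslash_excess (inverse q * x) y) ** R1"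
    by (simp flip: F0_backslash)
  finally show ?thesis .
qed

lemma R2F0: "R2 ** F0 = D (\<lambda>_ _. inverse q) ** (F0 ** R2)
      + D (\<lambda>x y. inverse q * slash_excess x y - slash_excess x (inverse q * y)) ** R2"
proof -
  have "R2 ** F0 = R2 ** (L1 ** R1 - R1 ** L1 - D slash_excess)" by (simp flip: F0_slash)
  also have "\<dots> = D (\<lambda>_ _. inverse q) ** ((L1 ** R1 - R1 ** L1 - D slash_excess) ** R2)
      + D (\<lambda>x y. inverse q * slash_excess x y - slash_excess x (inverse q * y)) ** R2"
    by (simp add: distrib matrix_mul_assoc[symmetric] diag R2R1 R2R1[THEN mult_tail] R2L1 R2L1[THEN mult_tail])
     (simp add: vec_eq_iff entries algebra_simps)
  also have "\<dots> = D (\<lambda>_ _. inverse q) ** (F0 ** R2)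
      + D (\<lambda>x y. inverse q * slash_excess x y - slash_excess x (inverse q * y)) ** R2"
    by (simp flip: F0_slash)
  finally show ?thesis .
qed

text \<open>
  As rewrite rules these equations move every letter \<open>L\<close> to the left and every \<open>R\<close> to the right of \<open>F0\<close>,
  which makes identities between words provable by comparing coefficients.
\<close>

lemmas normal_order = L2L1 L2L1[THEN mult_tail] R1R2 R1R2[THEN mult_tail] R2L1 R2L1[THEN mult_tail] R1L2 R1L2[THEN mult_tail]
  R1L1' R1L1'[THEN mult_tail] R2L2' R2L2'[THEN mult_tail]
  F0L1 F0L1[THEN mult_tail] F0L2 F0L2[THEN mult_tail] R1F0 R1F0[THEN mult_tail] R2F0 R2F0[THEN mult_tail]

abbreviation F where "F \<equiv> F0 + Fp + Fm"
abbreviation Rise where "Rise \<equiv> L1 ** R2"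
abbreviation Fall where "Fall \<equiv> L2 ** R1"

text \<open>
  The diagonal part of \<open>\<Omega>\<close> divided by \<open>A*\<close>.
\<close>

definition omega_diag where "omega_diag x y = - ((\<alpha> + \<alpha> / q) / x + x * y + y + y / q - 2 + \<alpha> * \<beta> / (x * y))"
definition Y_diag where "Y_diag x y = \<alpha> * \<beta> / (x * y) + x * y - (q - 1) / q"

text \<open>
  The excess of the coefficient of \<open>F0\<close> over that of \<open>Fp\<close> and \<open>Fm\<close> in \<open>- \<Omega>\<close>, divided by \<open>A*\<close>.
\<close>

definition "gap = (q^2 - 1) / q"

text \<open>
  The part of the first relation that raises \<open>i\<close> by one, divided by \<open>A*\<close>.  In normal order
  \<open>F0 ** Rise\<close>, \<open>Fm ** Rise\<close> and \<open>Fp ** Rise\<close> become \<open>q\<^sup>2 Rise F0\<close>, \<open>q Rise Fm - q\<^sup>2 Rise F0\<close> and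
  \<open>q Rise Fp - q\<^sup>2 Rise F0\<close> up to multiples of \<open>Rise\<close>, and the words of degree four cancel.
\<close>

lemma F_Rise: "D (\<lambda>_ _. q - 1) ** (F ** Rise) = D (\<lambda>_ _. q * (q - 1)) ** (Rise ** F)
   - D (\<lambda>_ _. gap) ** (F0 ** Rise) + D (\<lambda>x y. (q + 1) * Y_diag x y + omega_diag x y) ** Rise"
  by (simp add: Fp_L2R2 Fm_L1R1 distrib matrix_mul_assoc[symmetric] diag normal_order,
      simp add: vec_eq_iff entries nonzero q_minus_1,
      simp add: gap_def Y_diag_def omega_diag_def slash_excess_def backslash_excess_def
      count_defs nonzero q_minus_1 divide_simps,
      simp add: algebra_simps power2_eq_square)

text \<open>
  The part of the first relation that lowers \<open>i\<close> by one, divided by \<open>A*\<close>.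
\<close>

lemma F_Fall: "D (\<lambda>_ _. (q - 1) / q) ** (F ** Fall) = D (\<lambda>_ _. (q - 1) / q / q) ** (Fall ** F)
   + D (\<lambda>_ _. gap) ** (F0 ** Fall) - D (\<lambda>x y. (q + 1) / q * Y_diag x y + omega_diag x y) ** Fall"
  by (simp add: Fp_L2R2 Fm_L1R1 distrib matrix_mul_assoc[symmetric] diag normal_order,
      simp add: vec_eq_iff entries nonzero q_minus_1,
      simp add: gap_def Y_diag_def omega_diag_def slash_excess_def backslash_excess_def
      count_defs nonzero q_minus_1 divide_simps,
      simp add: algebra_simps power2_eq_square)

definition "Omega1_diag x y = q / (q - 1) * (\<alpha> / (x * y) + x - 1 / y - 1)"
definition "Omega2_diag x y = q / (q - 1) * (x * y / \<alpha> + \<beta> / y - x / \<alpha> - 1)"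

abbreviation "Omega1 \<equiv> D Omega1_diag + D (\<lambda>x y. q / y) ** F0 + D (\<lambda>x y. (q - 1) / y) ** Fm"
abbreviation "Omega2 \<equiv> D Omega2_diag + D (\<lambda>x y. q * x / \<alpha>) ** F0 + D (\<lambda>x y. (q - 1) * x / \<alpha>) ** Fp"

definition "P_diag x y = q / (q - 1)^2 * (Y_diag x y ^ 2 - \<alpha> * \<beta> / q^2 * (q + 1)^2)"

definition "G1_diag x y = (x * y * Y_diag x y - \<alpha> * \<beta> * (q + 1) / q) / (q - 1)"
definition "G2_diag x y = (\<alpha> * Y_diag x y - x * y * \<alpha> * (q + 1) / q) / (q - 1)"
definition "G3_diag x y = (q + 1) / (q - 1)^2 * ((x * y + \<alpha>) * Y_diag x y - (q + 1) / q * (\<alpha> * x * y + \<alpha> * \<beta>))"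
abbreviation "G \<equiv> - (D G1_diag ** Omega1) - D G2_diag ** Omega2 - D G3_diag"

text \<open>
  Reordering the letters lets the two slash and the two backslash matrices meet, so that the quartic word becomes
  a product of two of the matrices \<open>F0\<close>, \<open>Fp\<close>, \<open>Fm\<close> plus diagonals.
\<close>

lemma Rise_Fall: "Rise ** Fall = D (\<lambda>_ _. 1 / q) ** ((F0 + Fm + D (slash_up q \<alpha>)) ** (F0 + Fp + D (backslash_down q)))"
proof -
  have "Rise ** Fall = L1 ** (R2 ** R1) ** L2" by (simp add: matrix_mul_assoc R1L2[symmetric])
  also have "\<dots> = D (\<lambda>_ _. 1 / q) ** ((L1 ** R1) ** (R2 ** L2))"
    by (simp add: R2R1 matrix_mul_assoc[symmetric] diag) (simp add: inverse_eq_divide)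
  finally show ?thesis by (simp add: L1R1 R2L2)
qed

lemma Fall_Rise: "Fall ** Rise = D (\<lambda>_ _. q) ** ((Fm + D (slash_down q)) ** (Fp + D (backslash_up q \<alpha> \<beta>)))"
proof -
  have "Fall ** Rise = R1 ** (L2 ** L1) ** R2" by (simp add: matrix_mul_assoc R1L2)
  also have "\<dots> = D (\<lambda>_ _. q) ** ((R1 ** L1) ** (L2 ** R2))"
    by (simp add: L2L1 matrix_mul_assoc[symmetric] diag)
  finally show ?thesis by (simp add: R1L1 L2R2)
qed

text \<open>
  \<open>Fm\<close> is \<open>R1 L1\<close> up to a diagonal, and \<open>F0\<close> passes \<open>R1\<close> with the factor \<open>q\<^sup>-\<^sup>1\<close> and \<open>L1\<close> with \<open>q\<close>; the
  lower terms cancel as well.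
\<close>

lemma F0_Fm_commute: "F0 ** Fm = Fm ** F0"
  by (simp add: Fm_L1R1 distrib matrix_mul_assoc[symmetric] diag normal_order)
   (simp add: nonzero mult.assoc[symmetric])

text \<open>
  The part of the first relation that preserves the level.  After \<open>Rise_Fall\<close> and \<open>Fall_Rise\<close> the quadratic terms
  are \<open>(F0 + Fm) (F0 + Fp) - Fm Fp = F0 (F0 + Fp + Fm)\<close>, by commutativity of \<open>F0\<close> and \<open>Fm\<close>.  What remains is linear
  in \<open>F0\<close>, \<open>Fp\<close>, \<open>Fm\<close> and the identity, and each of the four coefficients vanishes.
\<close>

lemma F0_F: "D (\<lambda>x y. gap * x) ** (F0 ** F)
   = D (\<lambda>x y. gap * x * q) ** (Rise ** Fall)
   - D (\<lambda>x y. gap * x / q) ** (Fall ** Rise)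
   + D (\<lambda>x y. x * (2 * Y_diag x y + omega_diag x y)) ** F + D (\<lambda>x y. x * P_diag x y) + G"
proof -
  have c0: "gap * x * (slash_up q \<alpha> x y + backslash_down q x y) + x * (2 * Y_diag x y + omega_diag x y)
      = G1_diag x y * (q / y) + G2_diag x y * (q * x / \<alpha>)" if "x \<noteq> 0" "y \<noteq> 0" for x y
    using that nonzero q_minus_1 by
      (simp add: gap_def count_defs G1_diag_def G2_diag_def Y_diag_def omega_diag_def divide_simps, simp add: algebra_simps power2_eq_square)
  have cp: "gap * x * (slash_up q \<alpha> x y - slash_down q x y) + x * (2 * Y_diag x y + omega_diag x y)
      = G2_diag x y * ((q - 1) * x / \<alpha>)" if "x \<noteq> 0" "y \<noteq> 0" for x y
    using that nonzero q_minus_1 by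
      (simp add: gap_def count_defs G1_diag_def G2_diag_def Y_diag_def omega_diag_def divide_simps, simp add: algebra_simps power2_eq_square)
  have cm: "gap * x * (backslash_down q x y - backslash_up q \<alpha> \<beta> x y) + x * (2 * Y_diag x y + omega_diag x y)
      = G1_diag x y * ((q - 1) / y)" if "x \<noteq> 0" "y \<noteq> 0" for x y
    using that nonzero q_minus_1 by
      (simp add: gap_def count_defs G1_diag_def G2_diag_def Y_diag_def omega_diag_def divide_simps, simp add: algebra_simps power2_eq_square)
  have cI: "gap * x * (slash_up q \<alpha> x y * backslash_down q x y - slash_down q x y * backslash_up q \<alpha> \<beta> x y) + x * P_diag x y
      = G1_diag x y * Omega1_diag x y + G2_diag x y * Omega2_diag x y + G3_diag x y" if "x \<noteq> 0" "y \<noteq> 0" for x y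
    using that nonzero q_minus_1 by
      (simp add: gap_def count_defs G1_diag_def G2_diag_def G3_diag_def P_diag_def
        Omega1_diag_def Omega2_diag_def Y_diag_def omega_diag_def divide_simps,
        simp add: algebra_simps power2_eq_square)
  show ?thesis
    unfolding Rise_Fall Fall_Rise
    apply (simp add: distrib F0_Fm_commute matrix_mul_assoc[symmetric] diag)
    apply (simp add: vec_eq_iff entries nonzero)
  proof (intro allI, goal_cases)
    case (1 u v)
    have "(gap * a u * (slash_up q \<alpha> (a u) (b u) + backslash_down q (a u) (b u)) + a u * (2 * Y_diag (a u) (b u) + omega_diag (a u) (b u))
      - (G1_diag (a u) (b u) * (q / b u) + G2_diag (a u) (b u) * (q * a u / \<alpha>))) * F0 $ u $ v
      + (gap * a u * (slash_up q \<alpha> (a u) (b u) - slash_down q (a u) (b u)) + a u * (2 * Y_diag (a u) (b u) + omega_diag (a u) (b u))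
      - G2_diag (a u) (b u) * ((q - 1) * a u / \<alpha>)) * Fp $ u $ v
      + (gap * a u * (backslash_down q (a u) (b u) - backslash_up q \<alpha> \<beta> (a u) (b u)) + a u * (2 * Y_diag (a u) (b u) + omega_diag (a u) (b u))
      - G1_diag (a u) (b u) * ((q - 1) / b u)) * Fm $ u $ v
      + (gap * a u * (slash_up q \<alpha> (a u) (b u) * backslash_down q (a u) (b u)
          - slash_down q (a u) (b u) * backslash_up q \<alpha> \<beta> (a u) (b u))
        + a u * P_diag (a u) (b u)
      - (G1_diag (a u) (b u) * Omega1_diag (a u) (b u) + G2_diag (a u) (b u) * Omega2_diag (a u) (b u) + G3_diag (a u) (b u))) * mat 1 $ u $ v = 0"
      by (simp add: c0 cp cm cI nonzero)
    thus ?case by (simp add: algebra_simps)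
  qed
qed

abbreviation "As \<equiv> D (\<lambda>x y. x)"
abbreviation "A \<equiv> F0 + Fp + Fm + Rise + Fall"

definition Omega where "Omega = - (D (\<lambda>x y. x * y / q) ** (D (\<lambda>_ _. q - 1) ** Omega1 + D (\<lambda>_ _. q + 1)))
    - D (\<lambda>_ _. \<alpha> / q) ** (D (\<lambda>_ _. q - 1) ** Omega2 + D (\<lambda>_ _. q + 1))"

text \<open>
  Neither \<open>Rise\<close> nor \<open>Fall\<close> occurs in \<open>\<Omega>\<close>, hence \<open>\<Omega>\<close> preserves the level.
\<close>

lemma Omega: "Omega = D (\<lambda>x y. x * omega_diag x y) - D (\<lambda>x y. (q - 1)^2 / q * x) ** F - D (\<lambda>x y. gap * x) ** F0"
  unfolding Omega_def gap_def
  by (simp add: distrib diag,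
      simp add: vec_eq_iff entries nonzero Omega1_diag_def Omega2_diag_def omega_diag_def divide_simps,
      simp add: q_minus_1 algebra_simps power2_eq_square)

lemma graded_Rise: "graded a b q (inverse q) Rise"
  using graded by (intro graded_mult[where M = L1 and N = R2]) auto
lemma graded_Fall: "graded a b (inverse q) q Fall"
  using graded by (intro graded_mult[where M = L2 and N = R1]) auto
lemma graded_F: "graded a b 1 1 F"
  using graded by (intro graded_add) auto

lemma first_relation:
  "A ** A ** As - D (\<lambda>_ _. q + 1 / q) ** (A ** As ** A) + As ** A ** A
     - D Y_diag ** (A ** As + As ** A) - D P_diag ** As = Omega ** A + G"
proof -
  \<comment> \<open>The products are made opaque so that rewriting treats them as single letters.\<close>
  define f x z g where fxzg: "f = F" "x = Rise" "z = Fall" "g = G"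
  have gr: "graded a b q (inverse q) x" "graded a b (inverse q) q z" "graded a b 1 1 f"
    unfolding fxzg by (rule graded_Rise graded_Fall graded_F)+
  note sh = gr[THEN graded_mult_level_diag] gr[THEN graded_mult_level_diag, THEN mult_tail]
  note S = F_Rise[folded fxzg] F_Fall[folded fxzg] F0_F[folded fxzg]
  show ?thesis
    unfolding Omega fxzg[symmetric]
    apply (simp add: distrib matrix_mul_assoc[symmetric] diag sh)
    apply (simp add: vec_eq_iff entries nonzero)
  proof (intro allI, goal_cases)
    case (1 u v)
    note S' = S[unfolded vec_eq_iff, rule_format, of u v, simplified entries vector_add_component vector_minus_component]
    let "?l = ?r" = ?case
    \<comment> \<open>Sorted by the change of \<open>i\<close>, the difference is \<open>A*\<close> times the rising part, minus \<open>A*\<close> times the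
      falling part, plus the level-preserving part, in which \<open>A*\<close> is already contained.\<close>
    have "?l - ?r =
        a u * ((q - 1) * (f ** x) $ u $ v - (q * (q - 1) * (x ** f) $ u $ v - gap * (F0 ** x) $ u $ v +
          ((q + 1) * Y_diag (a u) (b u) + omega_diag (a u) (b u)) * x $ u $ v))
      - a u * ((q - 1) / q * (f ** z) $ u $ v - ((q - 1) / q / q * (z ** f) $ u $ v + gap * (F0 ** z) $ u $ v -
          ((q + 1) / q * Y_diag (a u) (b u) + omega_diag (a u) (b u)) * z $ u $ v))
      + (gap * a u * (F0 ** f) $ u $ v - (gap * a u * q * (x ** z) $ u $ v -
          gap * a u / q * (z ** x) $ u $ v +
          a u * (2 * Y_diag (a u) (b u) + omega_diag (a u) (b u)) * f $ u $ v +
          a u * P_diag (a u) (b u) * mat 1 $ u $ v + g $ u $ v))"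
      by (simp add: gap_def field_simps power2_eq_square nonzero)
    also have "\<dots> = 0" unfolding S' by simp
    finally show ?case by simp
  qed
qed

text \<open>
  The coefficient \<open>q + q\<^sup>-\<^sup>1\<close> kills the level-changing parts, because their \<open>A*\<close>-values differ by a factor
  \<open>q\<close> or \<open>q\<^sup>-\<^sup>1\<close>.  The last summand on the right is \<open>G*\<close> with \<open>\<Omega>\<^sub>0\<close> written out.
\<close>

lemma second_relation:
  "As ** As ** A - D (\<lambda>_ _. q + 1 / q) ** (As ** A ** As) + A ** As ** As
     = D Y_diag ** As ** As + Omega ** As + D (\<lambda>_ _. \<alpha> * (q + 1) / q) **
       ((D (\<lambda>x y. x / \<alpha> + 1 / y - x / (\<alpha> * y)) + D (\<lambda>_ _. q - 1) ** (F0 ** D (\<lambda>x y. x / (\<alpha> * y)))) ** D (\<lambda>x y. x * y))"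
proof -
  define f x z where fxz: "f = F" "x = Rise" "z = Fall"
  have gr: "graded a b q (inverse q) x" "graded a b (inverse q) q z" "graded a b 1 1 f"
    unfolding fxz by (rule graded_Rise graded_Fall graded_F)+
  note sh = gr[THEN graded_mult_level_diag] gr[THEN graded_mult_level_diag, THEN mult_tail]
  show ?thesis
    unfolding Omega fxz[symmetric]
    by (simp add: distrib matrix_mul_assoc[symmetric] diag sh,
        simp add: vec_eq_iff entries nonzero gap_def omega_diag_def Y_diag_def divide_simps,
        simp add: algebra_simps power2_eq_square)
qed

end

section \<open>The subspace lattice as a cover algebra\<close>

locale subspace_lattice = finite_space scale Basis
  for scale :: "'f::{field,finite} \<Rightarrow> 'v::ab_group_add \<Rightarrow> 'v" and Basis +
  fixes sub :: "'p::finite \<Rightarrow> 'v set" and y :: "'v set" and h k :: nat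
  assumes bij_sub: "bij_betw sub UNIV {U. subspace U}"
    and subspace_y: "subspace y" and dim_y: "dim y = k"
    and dim_UNIV_eq: "dim (UNIV :: 'v set) = h + k"
begin

lemma subspace_sub [simp]: "subspace (sub u)"
  using bij_betwE[OF bij_sub] by auto

lemma sub_eq_iff [simp]: "sub u = sub v \<longleftrightarrow> u = v"
  using bij_betw_imp_inj_on[OF bij_sub] by (auto dest: injD)

text \<open>
  Sums over matrix indices are counts of subspaces.
\<close>

lemma card_index: "card {w. P (sub w)} = card {W. subspace W \<and> P W}"
proof -
  have "sub ` {w. P (sub w)} = {W. subspace W \<and> P W}"
  proof (rule set_eqI, rule iffI)
    fix W assume W: "W \<in> {W. subspace W \<and> P W}"
    then obtain w where "W = sub w" using bij_betw_imp_surj_on[OF bij_sub] by blast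
    with W show "W \<in> sub ` {w. P (sub w)}" by blast
  qed auto
  hence "bij_betw sub {w. P (sub w)} {W. subspace W \<and> P W}"
    using bij_sub by (auto simp: bij_betw_def intro: inj_on_subset)
  thus ?thesis by (rule bij_betw_same_card)
qed

definition q :: complex where "q = of_nat CARD('f)"
definition \<alpha> :: complex where "\<alpha> = q ^ k"
definition \<beta> :: complex where "\<beta> = q ^ h"
definition a :: "'p \<Rightarrow> complex" where "a u = q ^ dim (sub u \<inter> y)"
definition b :: "'p \<Rightarrow> complex" where "b u = q ^ (dim (sub u) - dim (sub u \<inter> y))"

definition L1 :: "complex ^ 'p ^ 'p" where "L1 = zero_one_mat (\<lambda>u v. slash_covers scale y (sub v) (sub u))"
definition L2 :: "complex ^ 'p ^ 'p" where "L2 = zero_one_mat (\<lambda>u v. backslash_covers scale y (sub v) (sub u))"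
definition R1 :: "complex ^ 'p ^ 'p" where "R1 = zero_one_mat (\<lambda>u v. slash_covers scale y (sub u) (sub v))"
definition R2 :: "complex ^ 'p ^ 'p" where "R2 = zero_one_mat (\<lambda>u v. backslash_covers scale y (sub u) (sub v))"

lemma q_nonzero: "q \<noteq> 0" "q \<noteq> 1" "q - 1 \<noteq> 0"
proof -
  have "CARD('f) \<noteq> 0" "CARD('f) \<noteq> 1" using q_gt_1 by simp_all
  thus "q \<noteq> 0" "q \<noteq> 1" unfolding q_def by simp_all
  thus "q - 1 \<noteq> 0" by simp
qed

lemma dim_inter_y_le: "dim (sub u \<inter> y) \<le> dim (sub u)" "dim (sub u \<inter> y) \<le> k"
  using dim_subset[of "sub u \<inter> y" "sub u"] dim_subset[of "sub u \<inter> y" y] dim_y by auto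

text \<open>
  \<open>j \<le> h\<close>, because \<open>u + y\<close> fits into the ambient space.
\<close>

lemma dim_le_total: "dim (sub u) - dim (sub u \<inter> y) \<le> h"
proof -
  have "dim (sub u + y) + dim (sub u \<inter> y) = dim (sub u) + k"
    using dim_plus_inter[OF subspace_sub subspace_y] dim_y by simp
  moreover have "dim (sub u + y) \<le> h + k" using dim_subset[of "sub u + y" UNIV] dim_UNIV_eq by simp
  ultimately show ?thesis by simp
qed

lemma F_mats:
  "F0_mat scale sub y = zero_one_mat (\<lambda>u v. F0_rel y (sub u) (sub v))"
  "Fplus_mat scale sub y = zero_one_mat (\<lambda>u v. Fplus_rel y (sub u) (sub v))"
  "Fminus_mat scale sub y = zero_one_mat (\<lambda>u v. Fminus_rel y (sub u) (sub v))"
  by (simp_all add: F0_mat_def Fplus_mat_def Fminus_mat_def F0_rel_def Fplus_rel_def Fminus_rel_def)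

lemma zero_one_nth: "zero_one_mat R $ u $ v = of_bool (R u v)"
  by (simp add: zero_one_mat_def)

lemma graded_zero_one:
  assumes "\<And>u v. R u v \<Longrightarrow> a v = s * a u \<and> b v = t * b u"
  shows "graded a b s t (zero_one_mat R)"
  using assms by (auto simp: graded_def zero_one_nth)

lemma square_same_level:
  assumes "square (sub u) (sub v)" "dim (sub u \<inter> y) = dim (sub v \<inter> y)"
  shows "a v = a u" "b v = b u"
proof -
  have "dim (sub u) = dim (sub v)" using assms(1) by (simp add: square_def covers_def)
  thus "a v = a u" "b v = b u" using assms(2) by (simp_all add: a_def b_def)
qed

lemma card_eq_quotient:
  assumes "real c * (real CARD('f) - 1) = x" shows "of_nat c = of_real x / (q - 1)"
proof -
  have "of_nat c * (q - 1) = (of_real (real c * (real CARD('f) - 1)) :: complex)" by (simp add: q_def)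
  thus ?thesis using assms q_nonzero by (simp add: field_simps)
qed

lemma of_real_q: "complex_of_real (real CARD('f)) = q" by (simp add: q_def)

lemma diagonal_counts:
  "of_nat (card {w. subspace w \<and> slash_covers scale y w (sub u)}) = slash_up q \<alpha> (a u) (b u)"
  "of_nat (card {w. subspace w \<and> backslash_covers scale y w (sub u)}) = backslash_up q \<alpha> \<beta> (a u) (b u)"
  "of_nat (card {w. subspace w \<and> slash_covers scale y (sub u) w}) = slash_down q (a u) (b u)"
  "of_nat (card {w. subspace w \<and> backslash_covers scale y (sub u) w}) = backslash_down q (a u) (b u)"
proof -
  define i where "i = dim (sub u \<inter> y)"
  define j where "j = dim (sub u) - i"
  have le: "i \<le> k" "j \<le> h" "dim (sub u) = i + j"
    using dim_inter_y_le[of u] dim_le_total[of u] unfolding i_def j_def by simp_all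
  have ab: "a u = q ^ i" "b u = q ^ j" unfolding a_def b_def i_def j_def by (rule refl)+
  have al: "q ^ (k - i) = \<alpha> / a u" and be: "q ^ (h - j) = \<beta> / b u"
    unfolding \<alpha>_def \<beta>_def ab using le q_nonzero by (simp_all add: power_diff)
  note counts = card_eq_quotient[OF card_slash_covers[OF subspace_sub subspace_y, of u]]
    card_eq_quotient[OF card_backslash_covers[OF subspace_sub subspace_y, of u]]
    card_eq_quotient[OF card_slash_covered[OF subspace_sub subspace_y, of u]]
    card_eq_quotient[OF card_backslash_covered[OF subspace_sub subspace_y, of u]]
  have N: "h + k - (i + j) = (k - i) + (h - j)" using le by simp
  note counts' = counts[unfolded dim_y dim_UNIV_eq le(3) i_def[symmetric] N power_add
    , simplified of_real_diff of_real_mult of_real_power of_real_1 of_real_q add_diff_cancel_left']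
  show "of_nat (card {w. subspace w \<and> slash_covers scale y w (sub u)}) = slash_up q \<alpha> (a u) (b u)"
    unfolding counts' slash_up_def al ..
  show "of_nat (card {w. subspace w \<and> backslash_covers scale y w (sub u)}) = backslash_up q \<alpha> \<beta> (a u) (b u)"
    unfolding counts' backslash_up_def al be by (simp add: algebra_simps)
  show "of_nat (card {w. subspace w \<and> slash_covers scale y (sub u) w}) = slash_down q (a u) (b u)"
    unfolding counts' slash_down_def ab by (simp add: algebra_simps)
  show "of_nat (card {w. subspace w \<and> backslash_covers scale y (sub u) w}) = backslash_down q (a u) (b u)"
    unfolding counts' backslash_down_def ab ..
qed

lemma products_nth:
  "(L2 ** L1) $ u $ v = of_nat (card {W. subspace W \<and> backslash_covers scale y W (sub u) \<and> slash_covers scale y (sub v) W})"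
  "(L1 ** L2) $ u $ v = of_nat (card {W. subspace W \<and> slash_covers scale y W (sub u) \<and> backslash_covers scale y (sub v) W})"
  "(R1 ** R2) $ u $ v = of_nat (card {W. subspace W \<and> slash_covers scale y (sub u) W \<and> backslash_covers scale y W (sub v)})"
  "(R2 ** R1) $ u $ v = of_nat (card {W. subspace W \<and> backslash_covers scale y (sub u) W \<and> slash_covers scale y W (sub v)})"
  "(L1 ** R2) $ u $ v = of_nat (card {W. subspace W \<and> slash_covers scale y W (sub u) \<and> backslash_covers scale y W (sub v)})"
  "(L2 ** R1) $ u $ v = of_nat (card {W. subspace W \<and> backslash_covers scale y W (sub u) \<and> slash_covers scale y W (sub v)})"
  "(R1 ** L2) $ u $ v = of_nat (card {W. subspace W \<and> slash_covers scale y (sub u) W \<and> backslash_covers scale y (sub v) W})"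
  "(R2 ** L1) $ u $ v = of_nat (card {W. subspace W \<and> backslash_covers scale y (sub u) W \<and> slash_covers scale y (sub v) W})"
  "(L1 ** R1) $ u $ v = of_nat (card {W. subspace W \<and> slash_covers scale y W (sub u) \<and> slash_covers scale y W (sub v)})"
  "(R1 ** L1) $ u $ v = of_nat (card {W. subspace W \<and> slash_covers scale y (sub u) W \<and> slash_covers scale y (sub v) W})"
  "(L2 ** R2) $ u $ v = of_nat (card {W. subspace W \<and> backslash_covers scale y W (sub u) \<and> backslash_covers scale y W (sub v)})"
  "(R2 ** L2) $ u $ v = of_nat (card {W. subspace W \<and> backslash_covers scale y (sub u) W \<and> backslash_covers scale y (sub v) W})"
  unfolding L1_def L2_def R1_def R2_def zero_one_mult_nth card_index[symmetric] by (rule refl)+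

lemma product_eq_diag:
  fixes M N :: "complex ^ 'p ^ 'p"
  assumes "\<And>u v. u \<noteq> v \<Longrightarrow> M $ u $ v = N $ u $ v"
    and "\<And>u. M $ u $ u = g (a u) (b u)" "\<And>u. N $ u $ u = 0"
  shows "M = N + level_diag a b g"
proof -
  have "M $ u $ v = (N + level_diag a b g) $ u $ v" for u v
    using assms by (cases "u = v") (simp_all add: level_diag_def)
  thus ?thesis by (simp only: vec_eq_iff) blast
qed

lemma not_rel_self:
  "\<not> F0_rel y (sub u) (sub u)" "\<not> Fplus_rel y (sub u) (sub u)" "\<not> Fminus_rel y (sub u) (sub u)"
  by (simp_all add: rel_square subspace_y square_def)

text \<open>
  In the product of a cover matrix with its transpose the diagonal entries count covers, and the other
  entries come from squares.
\<close>

sublocale cover_algebra q \<alpha> \<beta> a b L1 L2 R1 R2 "F0_mat scale sub y" "Fplus_mat scale sub y" "Fminus_mat scale sub y"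
proof
  show "q \<noteq> 0" "q \<noteq> 1" "\<alpha> \<noteq> 0" "\<beta> \<noteq> 0" "a u \<noteq> 0" "b u \<noteq> 0" for u
    using q_nonzero by (simp_all add: \<alpha>_def \<beta>_def a_def b_def)
  have L: "a v = q * a u \<and> b v = 1 * b u" if "slash_covers scale y (sub v) (sub u)" for u v
    using that dim_inter_y_le[of u] by (auto simp: slash_covers_def covers_def a_def b_def)
  have L': "a v = 1 * a u \<and> b v = q * b u" if "backslash_covers scale y (sub v) (sub u)" for u v
    using that dim_inter_y_le[of u] by (auto simp: backslash_covers_def covers_def a_def b_def Suc_diff_le)
  show "graded a b q 1 L1" unfolding L1_def by (rule graded_zero_one) (rule L)
  show "graded a b 1 q L2" unfolding L2_def by (rule graded_zero_one) (rule L')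
  show "graded a b (inverse q) 1 R1" unfolding R1_def
    by (rule graded_zero_one) (use L q_nonzero in simp)
  show "graded a b 1 (inverse q) R2" unfolding R2_def
    by (rule graded_zero_one) (use L' q_nonzero in simp)
  show "graded a b 1 1 (F0_mat scale sub y)" "graded a b 1 1 (Fplus_mat scale sub y)" "graded a b 1 1 (Fminus_mat scale sub y)"
    unfolding F_mats by (rule graded_zero_one, use square_same_level in \<open>simp add: rel_square subspace_y\<close>)+
  show "L2 ** L1 = level_diag a b (\<lambda>_ _. q) ** (L1 ** L2)"
    by (simp add: vec_eq_iff level_diag_mult_nth products_nth card_backslash_slash_interval subspace_y q_def)
  have "(R1 ** R2) $ u $ v = q * (R2 ** R1) $ u $ v" for u v
  proof -
    have "{W. subspace W \<and> slash_covers scale y (sub u) W \<and> backslash_covers scale y W (sub v)}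
        = {W. subspace W \<and> backslash_covers scale y W (sub v) \<and> slash_covers scale y (sub u) W}"
      "{W. subspace W \<and> backslash_covers scale y (sub u) W \<and> slash_covers scale y W (sub v)}
        = {W. subspace W \<and> slash_covers scale y W (sub v) \<and> backslash_covers scale y (sub u) W}" by auto
    thus ?thesis by (simp add: products_nth card_backslash_slash_interval subspace_y q_def)
  qed
  thus "R1 ** R2 = level_diag a b (\<lambda>_ _. q) ** (R2 ** R1)"
    by (simp add: vec_eq_iff level_diag_mult_nth)
  show "R2 ** L1 = L1 ** R2"
    by (simp add: vec_eq_iff products_nth card_backslash_slash_below card_slash_backslash_above subspace_y)
  have "(R1 ** L2) $ u $ v = (L2 ** R1) $ u $ v" for u v
  proof -
    have "{W. subspace W \<and> slash_covers scale y (sub u) W \<and> backslash_covers scale y (sub v) W}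
        = {W. subspace W \<and> backslash_covers scale y (sub v) W \<and> slash_covers scale y (sub u) W}"
      "{W. subspace W \<and> backslash_covers scale y W (sub u) \<and> slash_covers scale y W (sub v)}
        = {W. subspace W \<and> slash_covers scale y W (sub v) \<and> backslash_covers scale y W (sub u)}" by auto
    thus ?thesis by (simp add: products_nth card_backslash_slash_below card_slash_backslash_above subspace_y)
  qed
  thus "R1 ** L2 = L2 ** R1" by (simp add: vec_eq_iff)
  show "L1 ** R1 = F0_mat scale sub y + Fminus_mat scale sub y + level_diag a b (slash_up q \<alpha>)"
    by (rule product_eq_diag) (simp_all add: products_nth F_mats zero_one_nth not_rel_self card_slash_slash_above subspace_y diagonal_counts)
  show "R1 ** L1 = Fminus_mat scale sub y + level_diag a b (slash_down q)"
    by (rule product_eq_diag) (simp_all add: products_nth F_mats zero_one_nth not_rel_self card_slash_slash_below subspace_y diagonal_counts)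
  show "L2 ** R2 = Fplus_mat scale sub y + level_diag a b (backslash_up q \<alpha> \<beta>)"
    by (rule product_eq_diag) (simp_all add: products_nth F_mats zero_one_nth not_rel_self card_backslash_backslash_above subspace_y diagonal_counts)
  show "R2 ** L2 = F0_mat scale sub y + Fplus_mat scale sub y + level_diag a b (backslash_down q)"
    by (rule product_eq_diag) (simp_all add: products_nth F_mats zero_one_nth not_rel_self card_backslash_backslash_below subspace_y diagonal_counts)
qed

lemma A_mat_eq: "A_mat scale sub = F0_mat scale sub y + Fplus_mat scale sub y + Fminus_mat scale sub y + L1 ** R2 + L2 ** R1"
proof -
  have "{W. subspace W \<and> backslash_covers scale y W (sub u) \<and> slash_covers scale y W (sub v)}
        = {W. subspace W \<and> slash_covers scale y W (sub v) \<and> backslash_covers scale y W (sub u)}" for u v by auto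
  moreover have "square (sub v) (sub u) = square (sub u) (sub v)" for u v
    by (auto simp: square_def add.commute)
  ultimately show ?thesis
    by (simp add: vec_eq_iff A_mat_def zero_one_nth F_mats products_nth card_slash_backslash_above subspace_y
         adjacent_cases[OF subspace_sub subspace_sub subspace_y])
qed

end

section \<open>The diagonal matrices in level coordinates\<close>

context subspace_lattice
begin

text \<open>
  Scalars are treated as level diagonals, so that a single set of rules moves all coefficients to the left.
\<close>

lemma scaleR_level: "c *\<^sub>R (M :: complex ^ 'p ^ 'p) = D (\<lambda>_ _. of_real c) ** M"
  by (simp add: vec_eq_iff level_diag_mult_nth scaleR_conv_of_real[where 'a = complex])

lemma mat_1_level: "mat 1 = D (\<lambda>_ _. 1)"
  by (simp add: vec_eq_iff level_diag_def mat_def)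

text \<open>
  The half-integral powers of \<open>q\<close> in the definitions of \<open>K\<^sub>1\<close>, \<open>K\<^sub>2\<close>, \<open>\<Omega>\<^sub>1\<close>, \<open>\<Omega>\<^sub>2\<close> are monomials in \<open>q\<^sup>k\<^sup>/\<^sup>2\<close> and
  \<open>q\<^sup>h\<^sup>/\<^sup>2\<close>.
\<close>

definition root_\<alpha> :: complex where "root_\<alpha> = of_real (real CARD('f) powr (real k / 2))"
definition root_\<beta> :: complex where "root_\<beta> = of_real (real CARD('f) powr (real h / 2))"

lemma root_params: "root_\<alpha> \<noteq> 0" "root_\<beta> \<noteq> 0" "\<alpha> = root_\<alpha> * root_\<alpha>" "\<beta> = root_\<beta> * root_\<beta>"
  using q_gt_1 by (auto simp: root_\<alpha>_def root_\<beta>_def \<alpha>_def \<beta>_def q_def powr_realpow simp flip: of_real_mult powr_add)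

lemma diag_mat_level:
  "(\<And>u. complex_of_real (d u) = g (a u) (b u)) \<Longrightarrow> diag_mat d = D g"
  by (simp add: diag_mat_def level_diag_def vec_eq_iff)

lemma level_index: "(THE (i, j). sub u \<in> level scale y i j) = (dim (sub u \<inter> y), dim (sub u) - dim (sub u \<inter> y))"
  using dim_inter_y_le(1)[of u] by (intro the_equality) (auto simp: level_def)

lemma As_eq: "Astar_mat scale sub y = D (\<lambda>x y. x)"
  unfolding Astar_mat_def by (rule diag_mat_level) (simp add: a_def q_def)

lemma K1_eq: "K1_mat scale sub y k = D (\<lambda>x y. root_\<alpha> / x)"
  unfolding K1_mat_def level_index using q_gt_1
  by (intro diag_mat_level) (simp add: a_def q_def root_\<alpha>_def powr_diff powr_realpow)

lemma K2_eq: "K2_mat scale sub y h = D (\<lambda>x y. y / root_\<beta>)"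
  unfolding K2_mat_def level_index using q_gt_1
  by (intro diag_mat_level) (simp add: b_def q_def root_\<beta>_def powr_diff powr_realpow)

lemma K1_inv_eq: "matrix_inv (D (\<lambda>x y. root_\<alpha> / x)) = D (\<lambda>x y. x / root_\<alpha>)"
  by (subst matrix_inv_level_diag) (simp_all add: root_params nonzero)

lemma K2_inv_eq: "matrix_inv (D (\<lambda>x y. y / root_\<beta>)) = D (\<lambda>x y. root_\<beta> / y)"
  by (subst matrix_inv_level_diag) (simp_all add: root_params nonzero)

lemma powr_eqs:
  defines "Q \<equiv> real CARD('f)"
  shows "complex_of_real (Q powr (- (real h + real k) / 2)) = 1 / (root_\<alpha> * root_\<beta>)"
    "complex_of_real (Q powr (real h / 2)) = root_\<beta>"
    "complex_of_real (Q powr (real k / 2)) = root_\<alpha>"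
    "complex_of_real (Q powr (- real h / 2)) = 1 / root_\<beta>"
    "complex_of_real (Q powr (- real k / 2)) = 1 / root_\<alpha>"
    "complex_of_real (Q powr (real k / 2 + 1)) = root_\<alpha> * q"
    "complex_of_real (Q powr (real h / 2 + 1)) = root_\<beta> * q"
    "complex_of_real (Q powr ((real h + real k) / 2)) = root_\<alpha> * root_\<beta>"
    "complex_of_real (Q powr ((real h + real k) / 2 + 1)) = root_\<alpha> * root_\<beta> * q"
    "complex_of_real (Q powr ((real h + real k) / 2 - 1)) = root_\<alpha> * root_\<beta> / q"
    "complex_of_real (Q powr (real k)) = root_\<alpha> * root_\<alpha>"
    "complex_of_real (Q powr (real k - 1)) = root_\<alpha> * root_\<alpha> / q"
    "complex_of_real (Q powr (real h + real k - 2)) = root_\<alpha> * root_\<alpha> * root_\<beta> * root_\<beta> / (q * q)"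
    "complex_of_real (Q powr ((real h + 3 * real k) / 2 - 1)) = root_\<alpha> * root_\<alpha> * root_\<alpha> * root_\<beta> / q"
proof -
  have Q: "Q > 1" "q = of_real Q" using q_gt_1 by (simp_all add: Q_def q_def)
  note [simp] = root_\<alpha>_def[folded Q_def] root_\<beta>_def[folded Q_def]
  have [simp]: "Q powr real k = Q powr (real k / 2) * Q powr (real k / 2)"
    "Q powr real h = Q powr (real h / 2) * Q powr (real h / 2)"
    "Q powr (3 * real k / 2) = Q powr (real k / 2) * Q powr (real k / 2) * Q powr (real k / 2)"
    by (simp_all add: field_simps flip: powr_add)
  have e: "- (real h + real k) / 2 = - (real k / 2 + real h / 2)" "(real h + real k) / 2 = real k / 2 + real h / 2"
    "real h + real k - 2 = real k / 2 + real k / 2 + real h / 2 + real h / 2 - 1 - 1"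
    "(real h + 3 * real k) / 2 = real k / 2 + real k / 2 + real k / 2 + real h / 2"
    "real k - 1 = real k / 2 + real k / 2 - 1" "- real h / 2 = - (real h / 2)" "- real k / 2 = - (real k / 2)"
    by (simp_all add: field_simps)
  show "complex_of_real (Q powr (- (real h + real k) / 2)) = 1 / (root_\<alpha> * root_\<beta>)"
    "complex_of_real (Q powr (real h / 2)) = root_\<beta>"
    "complex_of_real (Q powr (real k / 2)) = root_\<alpha>"
    "complex_of_real (Q powr (- real h / 2)) = 1 / root_\<beta>"
    "complex_of_real (Q powr (- real k / 2)) = 1 / root_\<alpha>"
    "complex_of_real (Q powr (real k / 2 + 1)) = root_\<alpha> * q"
    "complex_of_real (Q powr (real h / 2 + 1)) = root_\<beta> * q"
    "complex_of_real (Q powr ((real h + real k) / 2)) = root_\<alpha> * root_\<beta>"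
    "complex_of_real (Q powr ((real h + real k) / 2 + 1)) = root_\<alpha> * root_\<beta> * q"
    "complex_of_real (Q powr ((real h + real k) / 2 - 1)) = root_\<alpha> * root_\<beta> / q"
    "complex_of_real (Q powr (real k)) = root_\<alpha> * root_\<alpha>"
    "complex_of_real (Q powr (real k - 1)) = root_\<alpha> * root_\<alpha> / q"
    "complex_of_real (Q powr (real h + real k - 2)) = root_\<alpha> * root_\<alpha> * root_\<beta> * root_\<beta> / (q * q)"
    "complex_of_real (Q powr ((real h + 3 * real k) / 2 - 1)) = root_\<alpha> * root_\<alpha> * root_\<alpha> * root_\<beta> / q"
    using Q(1) unfolding e Q(2) by (simp_all add: powr_add powr_diff powr_minus_divide power2_eq_square)
qed

lemmas to_level = K1_inv_eq K2_inv_eq K1_eq K2_eq scaleR_level mat_1_level of_real_mult of_real_divide of_real_diff of_real_add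
  of_real_1 of_real_power of_real_inverse powr_eqs of_real_q

lemma Omega1_eq: "Omega1_mat scale sub y h k = Omega1"
  unfolding Omega1_mat_def Let_def to_level
  by (simp add: distrib matrix_mul_assoc[symmetric] diag,
      simp add: vec_eq_iff entries Omega1_diag_def nonzero,
      simp add: root_params nonzero q_minus_1 divide_simps,
      simp add: algebra_simps)

lemma Omega2_eq: "Omega2_mat scale sub y h k = Omega2"
  unfolding Omega2_mat_def Let_def to_level
  by (simp add: distrib matrix_mul_assoc[symmetric] diag,
      simp add: vec_eq_iff entries Omega2_diag_def nonzero,
      simp add: root_params nonzero q_minus_1 divide_simps,
      simp add: algebra_simps)

lemma Omega0_eq: "Omega0_mat scale sub y h k = D (\<lambda>x y. x / \<alpha> + 1 / y - x / (\<alpha> * y))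
      + D (\<lambda>_ _. q - 1) ** (F0_mat scale sub y ** D (\<lambda>x y. x / (\<alpha> * y)))"
  unfolding Omega0_mat_def Let_def to_level
  by (simp add: distrib matrix_mul_assoc[symmetric] diag,
      simp add: vec_eq_iff entries nonzero,
      simp add: root_params nonzero q_minus_1 divide_simps,
      simp add: algebra_simps)

end

theorem theorem7p1:
  fixes scale :: "'f::{field,finite} \<Rightarrow> 'v::ab_group_add \<Rightarrow> 'v"
    and sub :: "'p::finite \<Rightarrow> 'v set"
    and y :: "'v set"
    and h k :: nat
    and q h' k' :: real
    and A As K1 K2 K1' K2' \<Omega>\<^sub>0 \<Omega>\<^sub>1 \<Omega>\<^sub>2 Y P \<Omega> G Gs :: "complex ^ 'p ^ 'p"
  assumes hk: "1 \<le> k" "k < h"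
    and V: "vector_space scale" "vector_space.dim scale (UNIV :: 'v set) = h + k"
    and P_index: "bij_betw sub UNIV {U. module.subspace scale U}"
    and y: "module.subspace scale y" "vector_space.dim scale y = k"
    and q: "q = real CARD('f)"
    and real_hk: "h' = real h" "k' = real k"
    and A: "A = A_mat scale sub"
    and As: "As = Astar_mat scale sub y"
    and K1: "K1 = K1_mat scale sub y k" "K1' = matrix_inv K1"
    and K2: "K2 = K2_mat scale sub y h" "K2' = matrix_inv K2"
    and \<Omega>\<^sub>0: "\<Omega>\<^sub>0 = Omega0_mat scale sub y h k"
    and \<Omega>\<^sub>1: "\<Omega>\<^sub>1 = Omega1_mat scale sub y h k"
    and \<Omega>\<^sub>2: "\<Omega>\<^sub>2 = Omega2_mat scale sub y h k"
    and Y: "Y = q powr ((h' + k') / 2) *\<^sub>R (K1 ** K2' + K1' ** K2) - (inverse q * (q - 1)) *\<^sub>R mat 1"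
    and P: "P = (q / (q - 1)\<^sup>2) *\<^sub>R (Y ** Y - (q powr (h' + k' - 2) * (q + 1)\<^sup>2) *\<^sub>R mat 1)"
    and \<Omega>: "\<Omega> = - (q powr ((h' + k') / 2 - 1) *\<^sub>R (K1' ** K2 ** ((q - 1) *\<^sub>R \<Omega>\<^sub>1 + (q + 1) *\<^sub>R mat 1)))
                 - q powr (k' - 1) *\<^sub>R ((q - 1) *\<^sub>R \<Omega>\<^sub>2 + (q + 1) *\<^sub>R mat 1)"
    and G: "G = - ((1 / (q - 1)) *\<^sub>R
                    (q powr ((h' + k') / 2 - 1) *\<^sub>R
                       ((q *\<^sub>R (K1' ** K2 ** Y) - (q powr ((h' + k') / 2) * (q + 1)) *\<^sub>R mat 1) ** \<Omega>\<^sub>1)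
                   + q powr (k' - 1) *\<^sub>R
                       ((q *\<^sub>R Y - (q powr ((h' + k') / 2) * (q + 1)) *\<^sub>R (K1' ** K2)) ** \<Omega>\<^sub>2)))
                - ((q + 1) / (q - 1)\<^sup>2) *\<^sub>R
                    ((q powr ((h' + k') / 2) *\<^sub>R (K1' ** K2) + q powr k' *\<^sub>R mat 1) ** Y
                   - (q powr ((h' + k') / 2 - 1) * (q + 1)) *\<^sub>R
                       (q powr k' *\<^sub>R (K1' ** K2) + q powr ((h' + k') / 2) *\<^sub>R mat 1))"
    and Gs: "Gs = (q powr ((h' + 3 * k') / 2 - 1) * (q + 1)) *\<^sub>R (\<Omega>\<^sub>0 ** K1' ** K2)"
  shows "A ** A ** As - (q + inverse q) *\<^sub>R (A ** As ** A) + As ** A ** A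
           - Y ** (A ** As + As ** A) - P ** As = \<Omega> ** A + G
       \<and> As ** As ** A - (q + inverse q) *\<^sub>R (As ** A ** As) + A ** As ** As
           = Y ** As ** As + \<Omega> ** As + Gs"
proof -
  interpret vector_space scale by (rule V(1))
  \<comment> \<open>The dimension \<open>h + k\<close> is positive, and the dimension of a space without a finite basis is \<open>0\<close> by
    convention.  So there is a finite basis.\<close>
  obtain B where "independent B" "span B = UNIV" "card B = h + k"
    using basis_exists[of UNIV] V(2) by (metis top.extremum_uniqueI)
  moreover from this have "finite B" using hk by (intro card_ge_0_finite) simp
  ultimately interpret lat: subspace_lattice scale B sub y h k
    using P_index y V(2) by unfold_locales auto
  note to_level = lat.to_level lat.Omega0_eq lat.Omega1_eq lat.Omega2_eq
  have Yeq: "Y = lat.D lat.Y_diag"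
    unfolding Y K1 K2 q real_hk to_level
    by (simp add: lat.distrib matrix_mul_assoc[symmetric] lat.diag,
        simp add: vec_eq_iff lat.entries lat.Y_diag_def lat.nonzero,
        simp add: lat.root_params lat.nonzero lat.q_minus_1 divide_simps,
        simp add: algebra_simps)
  have Peq: "P = lat.D lat.P_diag"
    unfolding P q real_hk Yeq to_level
    by (simp add: lat.distrib matrix_mul_assoc[symmetric] lat.diag,
        simp add: vec_eq_iff lat.entries lat.P_diag_def lat.nonzero,
        simp add: lat.root_params lat.nonzero lat.q_minus_1 divide_simps,
        simp add: algebra_simps power2_eq_square)
  have \<Omega>eq: "\<Omega> = lat.Omega"
    unfolding \<Omega> K1 K2 \<Omega>\<^sub>1 \<Omega>\<^sub>2 q real_hk to_level
    by (simp add: lat.distrib matrix_mul_assoc[symmetric] lat.diag lat.Omega_def,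
        simp add: vec_eq_iff lat.entries lat.nonzero,
        simp add: lat.root_params lat.nonzero lat.q_minus_1 divide_simps)
  have Geq: "G = lat.G"
    unfolding G K1 K2 \<Omega>\<^sub>1 \<Omega>\<^sub>2 q real_hk Yeq to_level
    by (simp add: lat.distrib matrix_mul_assoc[symmetric] lat.diag,
        simp add: vec_eq_iff lat.entries lat.G1_diag_def lat.G2_diag_def lat.G3_diag_def lat.nonzero,
        simp add: lat.root_params lat.nonzero lat.q_minus_1 divide_simps,
        simp add: algebra_simps power2_eq_square)
  have Gseq: "Gs = lat.D (\<lambda>_ _. lat.\<alpha> * (lat.q + 1) / lat.q) **
       ((lat.D (\<lambda>x y. x / lat.\<alpha> + 1 / y - x / (lat.\<alpha> * y)) + lat.D (\<lambda>_ _. lat.q - 1) ** (F0_mat scale sub (y::'v set) ** lat.D (\<lambda>x y. x / (lat.\<alpha> * y)))) ** lat.D (\<lambda>x y. x * y))"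
    unfolding Gs K1 K2 \<Omega>\<^sub>0 q real_hk to_level
    by (simp add: lat.distrib matrix_mul_assoc[symmetric] lat.diag,
        simp add: vec_eq_iff lat.entries lat.nonzero,
        simp add: lat.root_params lat.nonzero lat.q_minus_1 divide_simps)
  have Aeq: "A = lat.A" unfolding A by (rule lat.A_mat_eq)
  have Aseq: "As = lat.As" unfolding As by (rule lat.As_eq)
  have qq: "of_real (q + inverse q) = lat.q + 1 / lat.q" unfolding q to_level by (simp add: inverse_eq_divide)
  show ?thesis
    using lat.first_relation lat.second_relation
    unfolding Yeq Peq \<Omega>eq Geq Gseq Aeq Aseq lat.scaleR_level qq by blast
qed

end
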